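(* Let $G$ be a totally disconnected locally compact group and $\phi:G\to G$ a topological automorphism. Then $\log s(\phi)=h_{top}(\phi)$ if and only if $\mathrm{nub}(\phi)=\{e_G\}$.
   Context: Let $G$ be a totally disconnected locally compact group with identity $e_G$. $\mathcal B(G)$ denotes the family of all compact open subgroups of $G$ (a local base at $e_G$ by van Dantzig's theorem). A topological automorphism is a group automorphism that is also a homeomorphism. $\mathbb N$ includes $0$. Scale: for $U\in\mathcal B(G)$ put $s(\phi,U)=[\phi(U):U\cap\phi(U)]$ (a finite index) and $s(\phi)=\min\{s(\phi,U):U\in\mathcal B(G)\}$. $U\in\mathcal B(G)$ is minimizing for $\phi$ if $s(\phi,U)=s(\phi)$. Topological entropy: for $U\in\mathcal B(G)$ and $n\ge 0$ put $U_{-n}=\bigcap_{k=-n}^0\phi^k(U)$, let $H_{top}(\phi,U)=\lim_{n\to\infty}\frac{\log[U:U_{-n}]}{n}$ (the limit exists), and $h_{top}(\phi)=\sup\{H_{top}(\phi,U):U\in\mathcal B(G)\}\in[0,\infty]$. Nub: $\mathrm{nub}(\phi)$ is the intersection of all $U\in\mathcal B(G)$ that are minimizing for $\phi$. (By a theorem of Willis, $U\in\mathcal B(G)$ is minimizing for $\phi$ if and only if it is tidy for $\phi$, i.e. $U=U_+U_-$ and $U_{++}$ is closed in $G$, where $U_+=\bigcap_{n\in\mathbb N}\phi^n(U)$, $U_-=\bigcap_{n\in\mathbb N}\phi^{-n}(U)$ and $U_{++}=\bigcup_{n\in\mathbb N}\phi^n(U_+)$.) *)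

theory Defs
  imports "HOL-Analysis.Analysis" "HOL-Algebra.Algebra"
begin

locale topological_group = group G for G (structure) +
  fixes T :: "'a topology"
  assumes topspace_eq: "topspace T = carrier G"
    and continuous_mult: "continuous_map (prod_topology T T) T (\<lambda>(x, y). x \<otimes> y)"
    and continuous_inv: "continuous_map T T (\<lambda>x. inv x)"

definition totally_disconnected_space :: "'a topology \<Rightarrow> bool" where
  "totally_disconnected_space T \<longleftrightarrow> (\<forall>x \<in> topspace T. connected_component_of_set T x = {x})"

text \<open>The Hausdorff property is not listed: in a topological group it follows from total
  disconnectedness, since connected components are closed.\<close>

locale tdlc_group = topological_group G T for G (structure) and T +
  assumes locally_compact: "locally_compact_space T"
    and totally_disconnected: "totally_disconnected_space T"

definition topological_automorphism ::
    "('a, 'b) monoid_scheme \<Rightarrow> 'a topology \<Rightarrow> ('a \<Rightarrow> 'a) \<Rightarrow> bool" where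
  "topological_automorphism G T \<phi> \<longleftrightarrow> \<phi> \<in> iso G G \<and> homeomorphic_map T T \<phi>"

definition compact_open_subgroups ::
    "('a, 'b) monoid_scheme \<Rightarrow> 'a topology \<Rightarrow> 'a set set" where
  "compact_open_subgroups G T = {U. subgroup U G \<and> compactin T U \<and> openin T U}"

text \<open>The index \<open>[K : H]\<close> of a subgroup \<open>H\<close> of \<open>K\<close>; it is 0 if there are infinitely many cosets,
  which does not happen for the compact open subgroups considered below.\<close>

definition subgroup_index :: "('a, 'b) monoid_scheme \<Rightarrow> 'a set \<Rightarrow> 'a set \<Rightarrow> nat" where
  "subgroup_index G K H = card (rcosets\<^bsub>G\<lparr>carrier := K\<rparr>\<^esub> H)"

definition scale_at :: "('a, 'b) monoid_scheme \<Rightarrow> ('a \<Rightarrow> 'a) \<Rightarrow> 'a set \<Rightarrow> nat" where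
  "scale_at G \<phi> U = subgroup_index G (\<phi> ` U) (U \<inter> \<phi> ` U)"

definition scale :: "('a, 'b) monoid_scheme \<Rightarrow> 'a topology \<Rightarrow> ('a \<Rightarrow> 'a) \<Rightarrow> nat" where
  "scale G T \<phi> = (LEAST n. \<exists>U \<in> compact_open_subgroups G T. n = scale_at G \<phi> U)"

definition minimizing ::
    "('a, 'b) monoid_scheme \<Rightarrow> 'a topology \<Rightarrow> ('a \<Rightarrow> 'a) \<Rightarrow> 'a set \<Rightarrow> bool" where
  "minimizing G T \<phi> U \<longleftrightarrow> U \<in> compact_open_subgroups G T \<and> scale_at G \<phi> U = scale G T \<phi>"

definition nub :: "('a, 'b) monoid_scheme \<Rightarrow> 'a topology \<Rightarrow> ('a \<Rightarrow> 'a) \<Rightarrow> 'a set" where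
  "nub G T \<phi> = \<Inter>{U. minimizing G T \<phi> U}"

text \<open>Integer powers of an automorphism. The inverse is taken relative to the carrier, because
  \<open>\<phi>\<close> is a bijection only there.\<close>

definition aut_power :: "('a, 'b) monoid_scheme \<Rightarrow> ('a \<Rightarrow> 'a) \<Rightarrow> int \<Rightarrow> 'a \<Rightarrow> 'a" where
  "aut_power G \<phi> k =
     (if 0 \<le> k then \<phi> ^^ nat k else inv_into (carrier G) \<phi> ^^ nat (- k))"

definition neg_cotrajectory ::
    "('a, 'b) monoid_scheme \<Rightarrow> ('a \<Rightarrow> 'a) \<Rightarrow> 'a set \<Rightarrow> nat \<Rightarrow> 'a set" where
  "neg_cotrajectory G \<phi> U n = (\<Inter>k \<in> {- int n..0}. aut_power G \<phi> k ` U)"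

definition top_entropy_at :: "('a, 'b) monoid_scheme \<Rightarrow> ('a \<Rightarrow> 'a) \<Rightarrow> 'a set \<Rightarrow> real" where
  "top_entropy_at G \<phi> U =
     lim (\<lambda>n. ln (real (subgroup_index G U (neg_cotrajectory G \<phi> U n))) / real n)"

definition top_entropy ::
    "('a, 'b) monoid_scheme \<Rightarrow> 'a topology \<Rightarrow> ('a \<Rightarrow> 'a) \<Rightarrow> ereal" where
  "top_entropy G T \<phi> = (SUP U \<in> compact_open_subgroups G T. ereal (top_entropy_at G \<phi> U))"

end

theory Submission
  imports Defs
begin

text \<open>
  For a compact open subgroup \<open>U\<close> and a set \<open>I\<close> of integers let \<open>U\<^bsub>I\<^esub>\<close> be the group of all \<open>x\<close> with
  \<open>\<phi>\<^sup>k x \<in> U\<close> for \<open>k \<in> I\<close>, and write \<open>s\<close> for the scale.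

  \<^bold>\<open>Entropy.\<close> The index \<open>a n\<close> of \<open>U\<^bsub>{0..n+1}\<^esub>\<close> in \<open>U\<^bsub>{0..n}\<^esub>\<close> decreases with \<open>n\<close>, hence is eventually equal to
  some \<open>\<alpha>(U)\<close>, and the entropy at \<open>U\<close> is \<open>ln \<alpha>(U)\<close> (\<open>top_entropy_at_eq\<close>). Moreover \<open>a n\<close> is the displacement
  index of the compact open subgroup \<open>U\<^bsub>{0..n}\<^esub>\<close> (\<open>scale_at_stay\<close>). So \<open>s \<le> \<alpha>(U)\<close>, and equality means
  that some \<open>U\<^bsub>{0..n}\<^esub>\<close> is minimizing. Therefore the entropy is \<open>ln s\<close> iff \<open>\<alpha>(U) = s\<close> for all \<open>U\<close>; in this
  case every \<open>U\<close> contains a minimizing subgroup, and the nub is trivial because compact open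
  subgroups are a base at \<open>\<one>\<close> (\<open>van_Dantzig\<close>).

  \<^bold>\<open>Trivial nub.\<close> Conversely, if the nub is trivial, then by compactness every \<open>U\<close> contains a finite
  intersection \<open>V\<close> of minimizing subgroups. As \<open>\<alpha>(U) \<le> \<alpha>(V)\<close>, it is enough that \<open>\<alpha>(V) = s\<close>. The link
  is the index \<open>b n\<close> of \<open>U\<^bsub>{0,n}\<^esub>\<close> in \<open>U\<close>, which ignores the intermediate times. It is submultiplicative, and
  up to a constant factor it does not depend on \<open>U\<close> (\<open>endpoint_index_compare\<close>). Its growth is at
  least that of \<open>s ^ n\<close> (\<open>scale_power_le_endpoint_index\<close>). For a minimizing \<open>W\<close> the index of
  \<open>W\<^bsub>{0..n}\<^esub>\<close> is at most \<open>s ^ n\<close>; so the two indices agree and \<open>W\<^bsub>{0,n}\<^esub> = W\<^bsub>{0..n}\<^esub>\<close>: an orbit segment with both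
  ends in \<open>W\<close> stays in \<open>W\<close> (\<open>minimizing_imp_orbit_convex\<close>). This convexity passes to the
  intersection \<open>V\<close>, where it says that \<open>\<alpha>(V)\<close> is the growth rate of \<open>b\<close>, which is \<open>s\<close>.

  \<^bold>\<open>The lower bound.\<close> It follows once orbit segments with ends in one compact open subgroup \<open>U\<close> all
  stay in another one (\<open>orbit_segments_captured\<close>). If \<open>a\<close> is constant, then \<open>U = U\<^sub>- U\<^sub>+\<close> by counting
  cosets and compactness, where \<open>U\<^sub>-\<close> and \<open>U\<^sub>+\<close> are the points staying in \<open>U\<close> in the future and in the past.
  With this factorization, a segment with ends in \<open>U\<close> can be moved by factors in \<open>U\<close> into the group
  \<open>L\<close> of points whose orbit leaves \<open>U\<close> only for a bounded time. This \<open>L\<close> is invariant and contained in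
  a compact set (\<open>bounded_core_subset_compact\<close>), so for a suitable \<open>L\<close>-normalized compact open subgroup
  \<open>W\<close> the group \<open>W L\<close> is compact and captures the segments.
\<close>

section \<open>Indices of subgroups\<close>

context group
begin

lemma subgroup_index_conv_card_image: "subgroup_index G A H = card ((\<lambda>x. H #> x) ` A)"
proof -
  have "rcosets\<^bsub>G\<lparr>carrier := A\<rparr>\<^esub> H = (\<lambda>x. H #> x) ` A"
    by (auto simp: RCOSETS_def r_coset_def)
  then show ?thesis
    by (simp add: subgroup_index_def)
qed

lemma rcoset_eq_iff:
  assumes "subgroup H G" "x \<in> carrier G" "y \<in> carrier G"
  shows "H #> x = H #> y \<longleftrightarrow> x \<otimes> inv y \<in> H"
proof
  assume "H #> x = H #> y"
  then have "x \<in> H #> y"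
    using assms rcos_self by blast
  then obtain h where "h \<in> H" "x = h \<otimes> y"
    by (auto simp: r_coset_def)
  then show "x \<otimes> inv y \<in> H"
    using assms by (simp add: subgroup.mem_carrier m_assoc)
next
  assume *: "x \<otimes> inv y \<in> H"
  have "x = (x \<otimes> inv y) \<otimes> y"
    using assms by (simp add: m_assoc)
  then have "x \<in> H #> y"
    using * by (auto simp: r_coset_def)
  then show "H #> x = H #> y"
    using assms repr_independence by metis
qed

text \<open>Pairs of an \<open>H\<close>-coset in \<open>A\<close> and a \<open>K\<close>-coset in \<open>H\<close> correspond to the \<open>K\<close>-cosets in \<open>A\<close>,
  once a representative of each \<open>H\<close>-coset is chosen.\<close>

lemma subgroup_index_tower:
  assumes K: "subgroup K G" and H: "subgroup H G" and A: "subgroup A G"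
    and KH: "K \<subseteq> H" and HA: "H \<subseteq> A"
  shows "subgroup_index G A K = subgroup_index G A H * subgroup_index G H K"
proof -
  define r where "r C = (SOME x. x \<in> A \<and> H #> x = C)" for C
  have r: "r C \<in> A \<and> H #> r C = C" if "C \<in> (\<lambda>x. H #> x) ` A" for C
    unfolding r_def using that by (intro someI_ex[of "\<lambda>x. x \<in> A \<and> H #> x = C"]) auto
  have inA: "x \<in> carrier G" if "x \<in> A" for x
    using subgroup.mem_carrier[OF A that] .
  have Ksub: "K \<subseteq> carrier G"
    using subgroup.subset[OF K] .
  define f where "f = (\<lambda>(C, D). D #> r C)"
  have f: "f (C, K #> h) = K #> (h \<otimes> r C)"
    if "C \<in> (\<lambda>x. H #> x) ` A" "h \<in> H" for C h
    using that r[OF that(1)] Ksub HA inA by (auto simp: f_def coset_mult_assoc)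
  have Hr: "H #> (h \<otimes> r C) = C"
    if "C \<in> (\<lambda>x. H #> x) ` A" "h \<in> H" for C h
  proof -
    have "h \<otimes> r C \<otimes> inv (r C) = h"
      using r[OF that(1)] that HA inA by (auto simp: m_assoc)
    then have "H #> (h \<otimes> r C) = H #> r C"
      using r[OF that(1)] that HA inA H by (subst rcoset_eq_iff) auto
    then show ?thesis
      using r[OF that(1)] by simp
  qed
  have "bij_betw f ((\<lambda>x. H #> x) ` A \<times> (\<lambda>x. K #> x) ` H) ((\<lambda>x. K #> x) ` A)"
    unfolding bij_betw_def
  proof
    show "inj_on f ((\<lambda>x. H #> x) ` A \<times> (\<lambda>x. K #> x) ` H)"
    proof (rule inj_onI, clarify)
      fix x h y h' assume *: "x \<in> A" "h \<in> H" "y \<in> A" "h' \<in> H"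
        and eq: "f (H #> x, K #> h) = f (H #> y, K #> h')"
      let ?C = "H #> x" and ?D = "H #> y"
      have rr: "r ?C \<in> carrier G" "r ?D \<in> carrier G" "h \<in> carrier G" "h' \<in> carrier G"
        using r * HA inA by auto
      have "K #> (h \<otimes> r ?C) = K #> (h' \<otimes> r ?D)"
        using eq * by (simp add: f)
      then have mem: "(h \<otimes> r ?C) \<otimes> inv (h' \<otimes> r ?D) \<in> K"
        using rr K by (subst (asm) rcoset_eq_iff) auto
      then have "H #> (h \<otimes> r ?C) = H #> (h' \<otimes> r ?D)"
        using rr H KH by (subst rcoset_eq_iff) auto
      then have CD: "?C = ?D"
        using Hr * by simp
      have "(h \<otimes> r ?C) \<otimes> inv (h' \<otimes> r ?C) = h \<otimes> inv h'"
        using rr by (simp add: inv_mult_group m_assoc)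
          (simp flip: m_assoc)
      then have "h \<otimes> inv h' \<in> K"
        using mem CD by simp
      then have "K #> h = K #> h'"
        using rr K by (subst rcoset_eq_iff) auto
      then show "?C = ?D \<and> K #> h = K #> h'"
        using CD by auto
    qed
    show "f ` ((\<lambda>x. H #> x) ` A \<times> (\<lambda>x. K #> x) ` H) = (\<lambda>x. K #> x) ` A"
    proof safe
      fix x h assume *: "x \<in> A" "h \<in> H"
      then have "h \<otimes> r (H #> x) \<in> A"
        using r HA A by (auto intro!: subgroup.m_closed)
      then show "f (H #> x, K #> h) \<in> (\<lambda>x. K #> x) ` A"
        using * by (simp add: f)
    next
      fix x assume x: "x \<in> A"
      let ?C = "H #> x"
      have rC: "r ?C \<in> A" "H #> r ?C = ?C"
        using r x by auto
      then have h: "x \<otimes> inv (r ?C) \<in> H"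
        using x inA H rcoset_eq_iff by metis
      moreover have "x \<otimes> inv (r ?C) \<otimes> r ?C = x"
        using x rC inA by (simp add: m_assoc)
      ultimately have "f (?C, K #> (x \<otimes> inv (r ?C))) = K #> x"
        using x f by simp
      then show "K #> x \<in> f ` ((\<lambda>x. H #> x) ` A \<times> (\<lambda>x. K #> x) ` H)"
        using h x by (metis (no_types, lifting) image_eqI mem_Sigma_iff)
    qed
  qed
  then show ?thesis
    by (metis bij_betw_same_card card_cartesian_product subgroup_index_conv_card_image)
qed

text \<open>Two elements of \<open>H\<close> are in the same \<open>H \<inter> K\<close>-coset iff they are in the same \<open>K\<close>-coset, so
  inside any \<open>A \<supseteq> H\<close> the \<open>H \<inter> K\<close>-cosets in \<open>H\<close> inject into the \<open>K\<close>-cosets in \<open>A\<close>; the injection is onto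
  precisely when \<open>A = K H\<close>.\<close>

lemma card_rcosets_Int:
  assumes K: "subgroup K G" and H: "subgroup H G"
  shows "card ((\<lambda>x. (H \<inter> K) #> x) ` H) = card ((\<lambda>x. K #> x) ` H)"
proof -
  have HK: "subgroup (H \<inter> K) G"
    using subgroups_Inter_pair[OF H K] .
  have c: "x \<in> carrier G" if "x \<in> H" for x
    using subgroup.mem_carrier[OF H that] .
  have eq: "(H \<inter> K) #> x = (H \<inter> K) #> y \<longleftrightarrow> K #> x = K #> y" if "x \<in> H" "y \<in> H" for x y
  proof -
    have "x \<otimes> inv y \<in> H"
      using that H by (simp add: subgroup.m_closed subgroup.m_inv_closed)
    then show ?thesis
      using that c K HK by (simp add: rcoset_eq_iff)
  qed
  define g where "g C = K #> (SOME x. x \<in> H \<and> (H \<inter> K) #> x = C)" for C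
  have g: "g ((H \<inter> K) #> x) = K #> x" if "x \<in> H" for x
  proof -
    have "(SOME y. y \<in> H \<and> (H \<inter> K) #> y = (H \<inter> K) #> x) \<in> H \<and>
        (H \<inter> K) #> (SOME y. y \<in> H \<and> (H \<inter> K) #> y = (H \<inter> K) #> x) = (H \<inter> K) #> x"
      using that by (intro someI_ex[of "\<lambda>y. y \<in> H \<and> (H \<inter> K) #> y = (H \<inter> K) #> x"]) auto
    then show ?thesis
      unfolding g_def using eq that by blast
  qed
  have "bij_betw g ((\<lambda>x. (H \<inter> K) #> x) ` H) ((\<lambda>x. K #> x) ` H)"
    unfolding bij_betw_def
  proof
    show "inj_on g ((\<lambda>x. (H \<inter> K) #> x) ` H)"
      by (auto simp: inj_on_def g eq)
    show "g ` (\<lambda>x. (H \<inter> K) #> x) ` H = (\<lambda>x. K #> x) ` H"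
      by (force simp: g image_iff)
  qed
  then show ?thesis
    by (rule bij_betw_same_card)
qed

lemma subgroup_index_Int_le:
  assumes "subgroup K G" "subgroup H G" "H \<subseteq> A" "finite ((\<lambda>x. K #> x) ` A)"
  shows "subgroup_index G H (H \<inter> K) \<le> subgroup_index G A K"
  unfolding subgroup_index_conv_card_image card_rcosets_Int[OF assms(1,2)]
  using assms by (intro card_mono) auto

lemma factorization_of_subgroup_index_Int_eq:
  assumes K: "subgroup K G" and H: "subgroup H G" and A: "subgroup A G" and "H \<subseteq> A"
    and "finite ((\<lambda>x. K #> x) ` A)"
    and "subgroup_index G A K \<le> subgroup_index G H (H \<inter> K)"
    and a: "a \<in> A"
  obtains k h where "k \<in> K" "h \<in> H" "a = k \<otimes> h"
proof -
  have "(\<lambda>x. K #> x) ` H = (\<lambda>x. K #> x) ` A"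
  proof (rule card_seteq)
    show "card ((\<lambda>x. K #> x) ` A) \<le> card ((\<lambda>x. K #> x) ` H)"
      using assms by (simp add: subgroup_index_conv_card_image card_rcosets_Int)
  qed (use assms in auto)
  then have "K #> a \<in> (\<lambda>x. K #> x) ` H"
    using a by simp
  then obtain h where h: "h \<in> H" "K #> a = K #> h"
    by blast
  have c: "h \<in> carrier G" "a \<in> carrier G"
    using h a subgroup.mem_carrier[OF H] subgroup.mem_carrier[OF A] by auto
  have "a \<otimes> inv h \<in> K"
    using h c K rcoset_eq_iff by metis
  moreover have "a = (a \<otimes> inv h) \<otimes> h"
    using c by (simp add: m_assoc)
  ultimately show ?thesis
    using h that by blast
qed

lemma subgroup_index_self:
  assumes "subgroup H G"
  shows "subgroup_index G H H = 1"
proof -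
  have "(\<lambda>x. H #> x) ` H = {H}"
    using subgroup.rcos_const[OF assms is_group] subgroup.one_closed[OF assms] by auto
  then show ?thesis
    by (simp add: subgroup_index_conv_card_image)
qed

lemma eq_if_subgroup_index_eq_1:
  assumes K: "subgroup K G" and H: "subgroup H G" and "K \<subseteq> H" and index: "subgroup_index G H K = 1"
  shows "K = H"
proof
  show "H \<subseteq> K"
  proof
    fix h assume h: "h \<in> H"
    obtain C where "(\<lambda>x. K #> x) ` H = {C}"
      using index by (auto simp: subgroup_index_conv_card_image card_1_singleton_iff)
    then have "K #> h = K #> \<one>"
      using h subgroup.one_closed[OF H] by (metis image_eqI singletonD)
    then show "h \<in> K"
      using h subgroup.mem_carrier[OF H] rcoset_eq_iff[OF K] by auto
  qed
qed fact

lemma subgroup_index_image: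
  assumes \<phi>: "\<phi> \<in> hom G G" "inj_on \<phi> (carrier G)" and A: "A \<subseteq> carrier G" and H: "H \<subseteq> carrier G"
  shows "subgroup_index G (\<phi> ` A) (\<phi> ` H) = subgroup_index G A H"
proof -
  have coset: "(\<phi> ` H) #> \<phi> x = \<phi> ` (H #> x)" if "x \<in> A" for x
  proof -
    have "\<phi> (h \<otimes> x) = \<phi> h \<otimes> \<phi> x" if "h \<in> H" for h
      using hom_mult[OF \<phi>(1)] that \<open>x \<in> A\<close> A H by auto
    then show ?thesis
      by (simp add: r_coset_def image_UN)
  qed
  have "(\<lambda>x. (\<phi> ` H) #> x) ` \<phi> ` A = (`) \<phi> ` ((\<lambda>x. H #> x) ` A)"
    by (simp add: image_image coset)
  moreover have "inj_on ((`) \<phi>) ((\<lambda>x. H #> x) ` A)"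
  proof (rule inj_on_subset[OF inj_on_image_Pow[OF \<phi>(2)]])
    show "(\<lambda>x. H #> x) ` A \<subseteq> Pow (carrier G)"
      using A H r_coset_subset_G by blast
  qed
  ultimately show ?thesis
    by (simp add: subgroup_index_conv_card_image card_image)
qed

end

section \<open>Compact open subgroups\<close>

context topological_group
begin

lemma continuous_map_mult [continuous_intros]:
  assumes "continuous_map Y T f" "continuous_map Y T g"
  shows "continuous_map Y T (\<lambda>x. f x \<otimes> g x)"
  using continuous_map_compose[OF continuous_map_pairedI[OF assms] continuous_mult]
  by (simp add: o_def)

lemma continuous_map_m_inv [continuous_intros]:
  assumes "continuous_map Y T f"
  shows "continuous_map Y T (\<lambda>x. inv (f x))"
  using continuous_map_compose[OF assms continuous_inv] by (simp add: o_def)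

lemma continuous_map_constI [continuous_intros]:
  assumes "a \<in> carrier G"
  shows "continuous_map Y T (\<lambda>x. a)"
  using assms by (simp add: topspace_eq)

lemma openin_vimage:
  assumes "continuous_map Y T f" "openin T V"
  shows "openin Y {x \<in> topspace Y. f x \<in> V}"
  using assms openin_continuous_map_preimage by blast

lemma openin_rcoset:
  assumes V: "openin T V" and a: "a \<in> carrier G"
  shows "openin T (V #> a)"
proof -
  have sub: "V \<subseteq> carrier G"
    using openin_subset[OF V] by (simp add: topspace_eq)
  have "V #> a = {x \<in> topspace T. x \<otimes> inv a \<in> V}"
  proof (intro Set.set_eqI iffI)
    fix x assume "x \<in> V #> a"
    then show "x \<in> {x \<in> topspace T. x \<otimes> inv a \<in> V}"
      using sub a by (auto simp: r_coset_def topspace_eq m_assoc subset_iff)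
  next
    fix x assume x: "x \<in> {x \<in> topspace T. x \<otimes> inv a \<in> V}"
    then have "x = (x \<otimes> inv a) \<otimes> a"
      using a by (simp add: topspace_eq m_assoc)
    then show "x \<in> V #> a"
      using x by (auto simp: r_coset_def)
  qed
  moreover have "continuous_map T T (\<lambda>x. x \<otimes> inv a)"
    using a by (intro continuous_intros continuous_map_id[unfolded id_def]) auto
  ultimately show ?thesis
    using V openin_vimage by metis
qed

text \<open>A subgroup containing an open neighbourhood \<open>V\<close> of \<open>\<one>\<close> is the union of the translates of \<open>V\<close> by its
  elements.\<close>

lemma openin_subgroupI:
  assumes H: "subgroup H G" and V: "openin T V" "\<one> \<in> V" "V \<subseteq> H"
  shows "openin T H"
proof -
  have "H = (\<Union>h\<in>H. V #> h)"
  proof (intro Set.set_eqI iffI)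
    fix h assume "h \<in> H"
    then have "h \<in> V #> h"
      using V(2) subgroup.mem_carrier[OF H] by (force simp: r_coset_def)
    then show "h \<in> (\<Union>h\<in>H. V #> h)"
      using \<open>h \<in> H\<close> by blast
  next
    fix x assume "x \<in> (\<Union>h\<in>H. V #> h)"
    then show "x \<in> H"
      using V(3) subgroup.m_closed[OF H] by (auto simp: r_coset_def)
  qed
  moreover have "openin T (\<Union>h\<in>H. V #> h)"
    using V(1) openin_rcoset subgroup.mem_carrier[OF H] by blast
  ultimately show ?thesis
    by simp
qed

lemma closedin_open_subgroup:
  assumes H: "subgroup H G" and open_H: "openin T H"
  shows "closedin T H"
proof -
  have sub: "H \<subseteq> carrier G"
    using subgroup.subset[OF H] .
  have "carrier G - H = (\<Union>x\<in>carrier G - H. H #> x)"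
  proof (intro Set.set_eqI iffI)
    fix x assume "x \<in> carrier G - H"
    then show "x \<in> (\<Union>x\<in>carrier G - H. H #> x)"
      using rcos_self[OF _ H] by blast
  next
    fix y assume "y \<in> (\<Union>x\<in>carrier G - H. H #> x)"
    then obtain x h where x: "x \<in> carrier G" "x \<notin> H" and h: "h \<in> H" "y = h \<otimes> x"
      by (auto simp: r_coset_def)
    have "inv h \<otimes> y = x"
      using x h sub by (simp add: subset_iff flip: m_assoc)
    then have "y \<notin> H"
      using x h subgroup.m_closed[OF H subgroup.m_inv_closed[OF H]] by metis
    then show "y \<in> carrier G - H"
      using x h sub by auto
  qed
  moreover have "openin T (\<Union>x\<in>carrier G - H. H #> x)"
    using open_H openin_rcoset by blast
  ultimately show ?thesis
    using sub by (simp add: closedin_def topspace_eq)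
qed

lemma compactin_set_mult:
  assumes "compactin T A" "compactin T B"
  shows "compactin T (A <#> B)"
proof -
  have "A <#> B = (\<lambda>(x, y). x \<otimes> y) ` (A \<times> B)"
    by (auto simp: set_mult_def)
  moreover have "compactin (prod_topology T T) (A \<times> B)"
    using assms by (simp add: compactin_Times)
  ultimately show ?thesis
    using image_compactin continuous_mult by metis
qed

text \<open>The cosets form a disjoint open cover of the compact set \<open>A\<close>, so a finite subcover contains
  all of them.\<close>

lemma finite_rcosets_of_open_subgroup:
  assumes A: "compactin T A" and H: "subgroup H G" "openin T H"
  shows "finite ((\<lambda>x. H #> x) ` A)"
proof -
  have sub: "A \<subseteq> carrier G"
    using compactin_subset_topspace[OF A] by (simp add: topspace_eq)
  have "\<forall>C \<in> (\<lambda>x. H #> x) ` A. openin T C" "A \<subseteq> \<Union>((\<lambda>x. H #> x) ` A)"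
    using sub H openin_rcoset rcos_self[OF _ H(1)] by blast+
  then obtain \<F> where \<F>: "finite \<F>" "\<F> \<subseteq> (\<lambda>x. H #> x) ` A" "A \<subseteq> \<Union>\<F>"
    using A unfolding compactin_def by meson
  have "(\<lambda>x. H #> x) ` A \<subseteq> \<F>"
  proof clarify
    fix x assume x: "x \<in> A"
    then obtain C where C: "C \<in> \<F>" "x \<in> C"
      using \<F>(3) by blast
    then obtain y where y: "y \<in> A" "H #> y \<in> \<F>" "x \<in> H #> y"
      using subsetD[OF \<F>(2) C(1)] by auto
    have "H #> y = H #> x"
      using repr_independence[OF y(3) _ H(1)] y(1) sub by blast
    then show "H #> x \<in> \<F>"
      using y(2) by simp
  qed
  then show ?thesis
    using \<F> finite_subset by blast
qed

lemma compact_open_subgroupsD: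
  assumes "U \<in> compact_open_subgroups G T"
  shows "subgroup U G" "compactin T U" "openin T U" "closedin T U" "U \<subseteq> carrier G" "\<one> \<in> U"
proof -
  show U: "subgroup U G" "compactin T U" "openin T U"
    using assms by (simp_all add: compact_open_subgroups_def)
  show "closedin T U" "U \<subseteq> carrier G" "\<one> \<in> U"
    using closedin_open_subgroup[OF U(1,3)] subgroup.subset[OF U(1)] subgroup.one_closed[OF U(1)] .
qed

lemma compact_open_subgroups_subset:
  assumes "U \<in> compact_open_subgroups G T" "subgroup H G" "openin T H" "H \<subseteq> U"
  shows "H \<in> compact_open_subgroups G T"
  using closed_compactin[OF compact_open_subgroupsD(2)[OF assms(1)] assms(4)
      closedin_open_subgroup[OF assms(2,3)]] assms(2,3)
  by (simp add: compact_open_subgroups_def)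

lemma Int_compact_open_subgroups:
  assumes "U \<in> compact_open_subgroups G T" "V \<in> compact_open_subgroups G T"
  shows "U \<inter> V \<in> compact_open_subgroups G T"
  using subgroups_Inter_pair[OF assms[THEN compact_open_subgroupsD(1)]]
    openin_Int[OF assms[THEN compact_open_subgroupsD(3)]]
  by (rule compact_open_subgroups_subset[OF assms(1)]) simp

lemma subgroup_index_pos:
  assumes "U \<in> compact_open_subgroups G T" "V \<in> compact_open_subgroups G T"
  shows "subgroup_index G U V > 0"
proof -
  have "finite ((\<lambda>x. V #> x) ` U)"
    using assms by (intro finite_rcosets_of_open_subgroup compact_open_subgroupsD(1-3))
  moreover have "U \<noteq> {}"
    using compact_open_subgroupsD(6)[OF assms(1)] by blast
  ultimately show ?thesis
    by (simp add: subgroup_index_conv_card_image card_gt_0_iff)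
qed

lemma compact_open_subgroup_index_tower:
  assumes "K \<in> compact_open_subgroups G T" "H \<in> compact_open_subgroups G T"
    "A \<in> compact_open_subgroups G T" "K \<subseteq> H" "H \<subseteq> A"
  shows "subgroup_index G A K = subgroup_index G A H * subgroup_index G H K"
  using assms by (intro subgroup_index_tower compact_open_subgroupsD(1))

lemma compact_open_subgroup_index_mono:
  assumes "K \<in> compact_open_subgroups G T" "H \<in> compact_open_subgroups G T"
    "A \<in> compact_open_subgroups G T" "K \<subseteq> H" "H \<subseteq> A"
  shows "subgroup_index G A H \<le> subgroup_index G A K"
  using compact_open_subgroup_index_tower[OF assms] subgroup_index_pos[OF assms(2,1)] by simp

lemma compact_open_subgroup_index_Int_le:
  assumes "K \<in> compact_open_subgroups G T" "H \<in> compact_open_subgroups G T"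
    "A \<in> compact_open_subgroups G T" "H \<subseteq> A"
  shows "subgroup_index G H (H \<inter> K) \<le> subgroup_index G A K"
  using assms
  by (intro subgroup_index_Int_le finite_rcosets_of_open_subgroup compact_open_subgroupsD(1-3))

text \<open>Distinct points \<open>x\<close>, \<open>y\<close> lie in the open set of pairs with quotient different from \<open>\<one>\<close>; an open box
  around \<open>(x, y)\<close> inside this set avoids the diagonal.\<close>

lemma Hausdorff_if_closed_one:
  assumes "closedin T {\<one>}"
  shows "Hausdorff_space T"
  unfolding Hausdorff_space_def
proof clarify
  fix x y assume xy: "x \<in> topspace T" "y \<in> topspace T" "x \<noteq> y"
  let ?W = "{p \<in> topspace (prod_topology T T). fst p \<otimes> inv (snd p) \<in> topspace T - {\<one>}}"
  have "openin (prod_topology T T) ?W"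
    using assms by (intro openin_vimage continuous_intros) (auto simp: closedin_def)
  moreover have "(x, y) \<in> ?W"
    using xy by (auto simp: topspace_eq inv_solve_right')
  ultimately obtain A B where "openin T A" "openin T B" "x \<in> A" "y \<in> B" and AB: "A \<times> B \<subseteq> ?W"
    unfolding openin_prod_topology_alt by meson
  moreover have "disjnt A B"
    using AB by (fastforce simp: disjnt_iff topspace_eq)
  ultimately show "\<exists>U V. openin T U \<and> openin T V \<and> x \<in> U \<and> y \<in> V \<and> disjnt U V"
    by blast
qed

text \<open>The stabilizer of \<open>C\<close> under right translation is a subgroup; it lies in \<open>C\<close> because
  \<open>\<one> \<in> C\<close>, and it is open because, by the tube lemma, all points near \<open>\<one>\<close> move
  the compact set \<open>C\<close> into its neighbourhood \<open>C\<close>.\<close>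

lemma compact_open_subgroup_inside:
  assumes C: "compactin T C" "openin T C" "\<one> \<in> C"
  obtains H where "H \<in> compact_open_subgroups G T" "H \<subseteq> C"
proof -
  have sub: "C \<subseteq> carrier G"
    using openin_subset[OF C(2)] by (simp add: topspace_eq)
  let ?W = "{p \<in> topspace (prod_topology T T). fst p \<otimes> snd p \<in> C}"
  have W: "openin (prod_topology T T) ?W"
    using C by (intro openin_vimage continuous_intros)
  have sub_W: "C \<times> {\<one>} \<subseteq> ?W"
    using sub C(3) by (auto simp: topspace_eq)
  have one: "compactin T {\<one>}"
    by (simp add: topspace_eq)
  obtain U V where UV: "openin T U" "openin T V" "C \<subseteq> U" "{\<one>} \<subseteq> V" "U \<times> V \<subseteq> ?W"
    by (rule Wallace_theorem_prod_topology[OF C(1) one W sub_W])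
  have CV: "c \<otimes> v \<in> C" if "c \<in> C" "v \<in> V" for c v
    using subsetD[OF UV(5), of "(c, v)"] subsetD[OF UV(3)] that by simp
  define H where "H = {x \<in> carrier G. \<forall>c\<in>C. c \<otimes> x \<in> C \<and> c \<otimes> inv x \<in> C}"
  have H: "subgroup H G"
  proof
    show "x \<otimes> y \<in> H" if "x \<in> H" "y \<in> H" for x y
    proof -
      have c: "c \<in> carrier G" if "c \<in> C" for c
        using that sub by blast
      have "c \<otimes> (x \<otimes> y) = (c \<otimes> x) \<otimes> y" "c \<otimes> inv (x \<otimes> y) = (c \<otimes> inv y) \<otimes> inv x"
        if "c \<in> C" for c
        using c[OF that] \<open>x \<in> H\<close> \<open>y \<in> H\<close> by (simp_all add: H_def inv_mult_group m_assoc)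
      then show ?thesis
        using that by (simp add: H_def)
    qed
    show "H \<subseteq> carrier G" "\<one> \<in> H"
      using sub by (auto simp: H_def)
    show "inv x \<in> H" if "x \<in> H" for x
      using that by (simp add: H_def)
  qed
  have "openin T (V \<inter> {x \<in> topspace T. inv x \<in> V})"
    using UV(2) openin_vimage[OF continuous_inv] by blast
  moreover have "V \<inter> {x \<in> topspace T. inv x \<in> V} \<subseteq> H"
    using CV by (auto simp: H_def topspace_eq)
  ultimately have open_H: "openin T H"
    using UV(4) by (intro openin_subgroupI[OF H]) (auto simp: topspace_eq)
  have "h \<in> C" if "h \<in> H" for h
  proof -
    have "\<one> \<otimes> h \<in> C" "h \<in> carrier G"
      using that C(3) unfolding H_def by blast+
    then show ?thesis
      by simp
  qed
  then have "H \<subseteq> C"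
    by blast
  moreover have "compactin T H"
    using closed_compactin[OF C(1) \<open>H \<subseteq> C\<close> closedin_open_subgroup[OF H open_H]] .
  ultimately show ?thesis
    using H open_H by (intro that) (simp_all add: compact_open_subgroups_def)
qed

end

context tdlc_group
begin

lemma connected_component_of_one: "connected_component_of_set T \<one> = {\<one>}"
proof -
  have "\<one> \<in> topspace T"
    by (simp add: topspace_eq)
  then show ?thesis
    using totally_disconnected unfolding totally_disconnected_space_def by (rule bspec[rotated])
qed

lemma Hausdorff: "Hausdorff_space T"
  using Hausdorff_if_closed_one closedin_connected_component_of[of T \<one>]
  unfolding connected_component_of_one .

text \<open>Van Dantzig's theorem: in a compact neighbourhood \<open>K\<close> of \<open>\<one>\<close>, components are intersections
  of clopen sets, so \<open>\<one>\<close> has a clopen neighbourhood in \<open>K\<close> that stays away from the boundary.\<close>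

theorem van_Dantzig:
  assumes N: "openin T N" "\<one> \<in> N"
  obtains U where "U \<in> compact_open_subgroups G T" "U \<subseteq> N"
proof -
  obtain M K where MK: "openin T M" "compactin T K" "\<one> \<in> M" "M \<subseteq> K"
  proof -
    have "\<one> \<in> topspace T"
      by (simp add: topspace_eq)
    then show ?thesis
      using locally_compact that unfolding locally_compact_space_def by blast
  qed
  let ?X = "subtopology T K"
  define Q where "Q = M \<inter> N"
  have Q: "openin T Q" "\<one> \<in> Q" "Q \<subseteq> K"
    using MK N by (auto simp: Q_def)
  have topX: "topspace ?X = K"
    using compactin_subset_topspace[OF MK(2)] by auto
  have H: "Hausdorff_space ?X" and c: "compact_space ?X"
    using Hausdorff Hausdorff_space_subtopology MK(2) compact_space_subtopology by blast+
  \<comment> \<open>No connected subset of \<open>K\<close> joins \<open>\<one>\<close> to \<open>K - Q\<close>, as the component of \<open>\<one>\<close> is trivial.\<close>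
  have "separated_between ?X {\<one>} (K - Q)"
  proof (rule cut_wire_fence_theorem[OF c H])
    show "closedin ?X {\<one>}"
      using Q topX by (intro closedin_Hausdorff_singleton[OF H]) auto
    show "closedin ?X (K - Q)"
      using Q(1,3) topX openin_subtopology_Int2[OF Q(1), of K]
      by (simp add: closedin_def Diff_Diff_Int)
    fix C assume "connectedin ?X C"
    then have "connectedin T C"
      using connectedin_subtopology by blast
    then have "C \<subseteq> {\<one>}" if "\<one> \<in> C"
      using connected_component_of_maximal[OF _ that] connected_component_of_one by metis
    then show "disjnt C {\<one>} \<or> disjnt C (K - Q)"
      using Q by (auto simp: disjnt_iff)
  qed
  then obtain C D where "openin ?X C" "openin ?X D" "C \<union> D = topspace ?X" "disjnt C D"
      "{\<one>} \<subseteq> C" "K - Q \<subseteq> D"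
    unfolding separated_between_def by blast
  then have CD: "openin ?X C" "openin ?X D" "C \<union> D = K" "disjnt C D" "\<one> \<in> C" "K - Q \<subseteq> D"
    unfolding topX by auto
  have CQ: "C \<subseteq> Q"
    using CD by (auto simp: disjnt_iff)
  have "C = K - D"
    using CD by (auto simp: disjnt_iff)
  then have "closedin ?X C"
    using CD(2) topX by (metis closedin_diff closedin_topspace)
  then have "compactin T C"
    using c closedin_compact_space compactin_subtopology by blast
  moreover obtain W where W: "openin T W" "C = W \<inter> K"
    using CD(1) by (auto simp: openin_subtopology)
  have "C = W \<inter> Q"
    using W CQ Q(3) by blast
  then have "openin T C"
    using W(1) Q(1) by blast
  ultimately obtain U where "U \<in> compact_open_subgroups G T" "U \<subseteq> C"
    using compact_open_subgroup_inside CD(5) by blast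
  then show ?thesis
    using CQ that by (auto simp: Q_def)
qed

lemma compact_open_subgroup_exists: "\<exists>U. U \<in> compact_open_subgroups G T"
  using van_Dantzig[of "topspace T"] by (metis one_closed openin_topspace topspace_eq)

lemma Inter_compact_open_subgroups: "\<Inter>(compact_open_subgroups G T) = {\<one>}"
proof -
  have "\<exists>U\<in>compact_open_subgroups G T. x \<notin> U" if "x \<noteq> \<one>" "x \<in> carrier G" for x
  proof -
    have "openin T (topspace T - {x})"
      using closedin_Hausdorff_singleton[OF Hausdorff, of x] that(2)
      by (simp add: closedin_def topspace_eq)
    then show ?thesis
      using that van_Dantzig[of "topspace T - {x}"] by (auto simp: topspace_eq)
  qed
  moreover have "\<one> \<in> \<Inter>(compact_open_subgroups G T)"
    using compact_open_subgroupsD(6) by blast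
  ultimately show ?thesis
    using compact_open_subgroup_exists compact_open_subgroupsD(5) by blast
qed

end

section \<open>Orbits that stay in a compact open subgroup\<close>

locale tdlc_automorphism = tdlc_group G T for G (structure) and T +
  fixes \<phi> :: "'a \<Rightarrow> 'a"
  assumes automorphism: "topological_automorphism G T \<phi>"
begin

abbreviation iter :: "int \<Rightarrow> 'a \<Rightarrow> 'a" ("\<Phi>")
  where "\<Phi> \<equiv> aut_power G \<phi>"

lemma automorphism_iso: "\<phi> \<in> iso G G"
  using automorphism by (simp add: topological_automorphism_def)

lemma inverse_iso: "inv_into (carrier G) \<phi> \<in> iso G G"
  using iso_set_sym[OF automorphism_iso] .

lemma automorphism_continuous: "continuous_map T T \<phi>"
  using automorphism by (simp add: topological_automorphism_def homeomorphic_imp_continuous_map)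

lemma inverse_continuous: "continuous_map T T (inv_into (carrier G) \<phi>)"
proof -
  obtain g where g: "homeomorphic_maps T T \<phi> g"
    using automorphism by (auto simp: topological_automorphism_def homeomorphic_map_maps)
  have "inv_into (carrier G) \<phi> x = g x" if "x \<in> topspace T" for x
  proof -
    have "\<phi> (g x) = x" "g x \<in> carrier G" "inj_on \<phi> (carrier G)"
      using g that automorphism_iso by (auto simp: homeomorphic_maps_def iso_def bij_betw_def topspace_eq
          continuous_map_def)
    then show ?thesis
      by (metis inv_into_f_f)
  qed
  then show ?thesis
    using g continuous_map_eq[of T T g] by (simp add: homeomorphic_maps_def)
qed

lemma funpow_iso: "f \<in> iso G G \<Longrightarrow> f ^^ n \<in> iso G G"
proof (induction n)
  case 0
  show ?case
    by (auto simp: iso_def hom_def bij_betw_def)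
next
  case (Suc n)
  then show ?case
    using iso_set_trans[of "f ^^ n" G G f G] by (simp add: o_def comp_def)
qed

lemma funpow_continuous: "continuous_map T T f \<Longrightarrow> continuous_map T T (f ^^ n)"
proof (induction n)
  case 0
  show ?case
    by (simp add: id_def[symmetric])
next
  case (Suc n)
  then show ?case
    using continuous_map_compose[of T T "f ^^ n" T f] by (simp add: o_def)
qed

lemma iter_iso: "\<Phi> k \<in> iso G G"
  using funpow_iso[OF automorphism_iso] funpow_iso[OF inverse_iso] by (simp add: aut_power_def)

lemma iter_continuous: "continuous_map T T (\<Phi> k)"
  using funpow_continuous[OF automorphism_continuous] funpow_continuous[OF inverse_continuous]
  by (simp add: aut_power_def)

lemma iter_hom: "\<Phi> k \<in> hom G G"
  using iter_iso by (simp add: iso_def)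

lemma iter_inj: "inj_on (\<Phi> k) (carrier G)"
  using iter_iso by (auto simp: iso_def bij_betw_def)

lemma iter_closed [simp, intro]: "x \<in> carrier G \<Longrightarrow> \<Phi> k x \<in> carrier G"
  using iter_hom by (auto simp: hom_def)

lemma iter_mult: "x \<in> carrier G \<Longrightarrow> y \<in> carrier G \<Longrightarrow> \<Phi> k (x \<otimes> y) = \<Phi> k x \<otimes> \<Phi> k y"
  using iter_hom by (rule hom_mult)

lemma iter_one [simp]: "\<Phi> k \<one> = \<one>"
  using iter_hom hom_one is_group by blast

lemma iter_inv: "x \<in> carrier G \<Longrightarrow> \<Phi> k (inv x) = inv (\<Phi> k x)"
  using group_hom.hom_inv[OF group_hom.intro[OF is_group is_group]] iter_hom
  by (auto simp: group_hom_axioms_def)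

lemma iter_0 [simp]: "\<Phi> 0 x = x"
  by (simp add: aut_power_def)

lemma iter_1: "\<Phi> 1 = \<phi>"
  by (rule ext) (simp add: aut_power_def)

lemma iter_succ:
  assumes "x \<in> carrier G"
  shows "\<Phi> (k + 1) x = \<phi> (\<Phi> k x)"
proof (cases "k \<ge> 0")
  case True
  then show ?thesis
    by (simp add: aut_power_def nat_add_distrib)
next
  case False
  then have k: "nat (- k) = Suc (nat (- (k + 1)))"
    by simp
  let ?\<psi> = "inv_into (carrier G) \<phi>"
  have "(?\<psi> ^^ nat (- (k + 1))) x \<in> carrier G"
    using funpow_iso[OF inverse_iso] assms by (auto simp: iso_def hom_def)
  then have "\<phi> (?\<psi> ((?\<psi> ^^ nat (- (k + 1))) x)) = (?\<psi> ^^ nat (- (k + 1))) x"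
    using automorphism_iso by (intro f_inv_into_f) (auto simp: iso_def bij_betw_def)
  moreover have "\<Phi> k x = ?\<psi> ((?\<psi> ^^ nat (- (k + 1))) x)"
    using False k by (simp add: aut_power_def)
  moreover have "\<Phi> (k + 1) x = (?\<psi> ^^ nat (- (k + 1))) x"
    using False by (cases "k = -1") (auto simp: aut_power_def)
  ultimately show ?thesis
    by simp
qed

lemma iter_add:
  assumes x: "x \<in> carrier G"
  shows "\<Phi> (j + k) x = \<Phi> j (\<Phi> k x)"
proof (induction j rule: int_induct[where k = 0])
  case base
  show ?case
    by simp
next
  case (step1 j)
  then show ?case
    using x iter_succ[of x "j + k"] iter_succ[of "\<Phi> k x" j] by (simp add: algebra_simps)
next
  case (step2 j)
  have "\<phi> (\<Phi> (j - 1 + k) x) = \<phi> (\<Phi> (j - 1) (\<Phi> k x))"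
    using step2 x iter_succ[of x "j - 1 + k"] iter_succ[of "\<Phi> k x" "j - 1"]
    by (simp add: algebra_simps)
  then show ?case
    using x iter_inj[of 1] by (simp add: iter_1 inj_on_eq_iff)
qed

lemma iter_neg [simp]: "x \<in> carrier G \<Longrightarrow> \<Phi> k (\<Phi> (- k) x) = x" "x \<in> carrier G \<Longrightarrow> \<Phi> (- k) (\<Phi> k x) = x"
  using iter_add[of x k "- k"] iter_add[of x "- k" k] by auto

text \<open>The points whose orbit is in \<open>U\<close> at all times in \<open>I\<close>. Allowing an arbitrary set of times treats
  uniformly the cotrajectories \<open>stay U {0..n}\<close>, the groups \<open>U\<^sub>-\<close> and \<open>U\<^sub>+\<close> of the theory of tidy
  subgroups, which are \<open>stay U {0..}\<close> and \<open>stay U {..0}\<close>, and the sets \<open>stay U {0, n}\<close> that constrain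
  only the two ends of an orbit segment.\<close>

definition stay :: "'a set \<Rightarrow> int set \<Rightarrow> 'a set"
  where "stay U I = {x \<in> carrier G. \<forall>k\<in>I. \<Phi> k x \<in> U}"

lemma stay_Un: "stay U (I \<union> J) = stay U I \<inter> stay U J"
  by (auto simp: stay_def)

lemma stay_antimono: "I \<subseteq> J \<Longrightarrow> stay U J \<subseteq> stay U I"
  by (auto simp: stay_def)

lemma stay_mono: "U \<subseteq> V \<Longrightarrow> stay U I \<subseteq> stay V I"
  by (auto simp: stay_def)

lemma stay_subset: "0 \<in> I \<Longrightarrow> stay U I \<subseteq> U"
  by (auto simp: stay_def)

lemma stay_0: "U \<subseteq> carrier G \<Longrightarrow> stay U {0} = U"
  by (auto simp: stay_def)

lemma stay_stay: "stay (stay U I) J = stay U (\<Union>j\<in>J. (\<lambda>i. i + j) ` I)"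
  by (auto simp: stay_def iter_add)

lemma iter_image_stay: "\<Phi> j ` stay U I = stay U ((\<lambda>k. k - j) ` I)"
proof (intro Set.set_eqI iffI)
  fix y assume "y \<in> \<Phi> j ` stay U I"
  then obtain x where x: "x \<in> carrier G" "\<forall>k\<in>I. \<Phi> k x \<in> U" "y = \<Phi> j x"
    by (auto simp: stay_def)
  have "\<Phi> (k - j) y = \<Phi> k x" for k
    using x iter_add[of x "k - j" j] by simp
  then show "y \<in> stay U ((\<lambda>k. k - j) ` I)"
    using x by (auto simp: stay_def)
next
  fix y assume y: "y \<in> stay U ((\<lambda>k. k - j) ` I)"
  then have c: "y \<in> carrier G"
    by (simp add: stay_def)
  have "\<Phi> k (\<Phi> (- j) y) = \<Phi> (k - j) y" for k
    using c iter_add[of y k "- j"] by simp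
  then have "\<Phi> (- j) y \<in> stay U I"
    using y by (auto simp: stay_def)
  then show "y \<in> \<Phi> j ` stay U I"
    using c iter_neg(1)[of y j] by (metis image_eqI)
qed

lemma subgroup_stay:
  assumes U: "subgroup U G"
  shows "subgroup (stay U I) G"
proof
  show "x \<otimes> y \<in> stay U I" if "x \<in> stay U I" "y \<in> stay U I" for x y
    using that subgroup.m_closed[OF U] by (auto simp: stay_def iter_mult)
  show "inv x \<in> stay U I" if "x \<in> stay U I" for x
    using that subgroup.m_inv_closed[OF U] by (auto simp: stay_def iter_inv)
qed (use subgroup.one_closed[OF U] in \<open>auto simp: stay_def\<close>)

lemma stay_conv_Inter: "I \<noteq> {} \<Longrightarrow> stay U I = (\<Inter>k\<in>I. {x \<in> topspace T. \<Phi> k x \<in> U})"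
  by (auto simp: stay_def topspace_eq)

lemma openin_stay:
  assumes "openin T U" "finite I" "I \<noteq> {}"
  shows "openin T (stay U I)"
  using assms openin_vimage[OF iter_continuous] by (auto simp: stay_conv_Inter intro!: openin_INT2)

lemma closedin_stay:
  assumes "closedin T U" "I \<noteq> {}"
  shows "closedin T (stay U I)"
  using assms closedin_continuous_map_preimage[OF iter_continuous]
  by (auto simp: stay_conv_Inter intro!: closedin_INT)

lemma compactin_stay:
  assumes U: "U \<in> compact_open_subgroups G T" and "I \<noteq> {}"
  shows "compactin T (stay U I)"
proof -
  obtain k where k: "k \<in> I"
    using assms by blast
  have "stay U {k} = \<Phi> (- k) ` U"
    using iter_image_stay[of "- k" U "{0}"] stay_0 compact_open_subgroupsD(5)[OF U] by simp
  then have "compactin T (stay U {k})"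
    using image_compactin iter_continuous compact_open_subgroupsD(2)[OF U] by metis
  then show ?thesis
    using closed_compactin stay_antimono[of "{k}" I] k closedin_stay compact_open_subgroupsD(4)[OF U]
    by blast
qed

lemma stay_compact_open_subgroup:
  assumes "U \<in> compact_open_subgroups G T" "finite I" "I \<noteq> {}"
  shows "stay U I \<in> compact_open_subgroups G T"
  using compactin_stay[OF assms(1,3)] openin_stay[OF compact_open_subgroupsD(3)[OF assms(1)] assms(2,3)]
    subgroup_stay[OF compact_open_subgroupsD(1)[OF assms(1)]]
  by (simp add: compact_open_subgroups_def)

lemma index_stay_shift:
  "subgroup_index G (stay U ((\<lambda>k. k - j) ` I)) (stay U ((\<lambda>k. k - j) ` J)) =
   subgroup_index G (stay U I) (stay U J)"
  unfolding iter_image_stay[symmetric] using iter_hom iter_inj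
  by (intro subgroup_index_image) (auto simp: stay_def)

text \<open>The more times are already constrained, the less a further constraint cuts down.\<close>

lemma index_stay_le:
  assumes U: "U \<in> compact_open_subgroups G T"
    and "finite I" "I' \<noteq> {}" "I' \<subseteq> I" "finite J"
  shows "subgroup_index G (stay U I) (stay U (I \<union> J)) \<le> subgroup_index G (stay U I') (stay U (I' \<union> J))"
proof -
  have "I \<union> J = I \<union> (I' \<union> J)"
    using assms by blast
  then have eq: "stay U (I \<union> J) = stay U I \<inter> stay U (I' \<union> J)"
    by (simp flip: stay_Un)
  show ?thesis
    unfolding eq using assms stay_antimono[of I' I]
    by (intro compact_open_subgroup_index_Int_le stay_compact_open_subgroup) (auto intro: finite_subset)
qed

text \<open>The three indices measure the cost of extending an orbit segment in \<open>U\<close> by one time unit,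
  of keeping a whole segment of length \<open>n\<close> in \<open>U\<close>, and of keeping only its end in \<open>U\<close>.\<close>

definition step_index :: "'a set \<Rightarrow> nat \<Rightarrow> nat"
  where "step_index U n = subgroup_index G (stay U {0..int n}) (stay U {0..int n + 1})"

definition orbit_index :: "'a set \<Rightarrow> nat \<Rightarrow> nat"
  where "orbit_index U n = subgroup_index G U (stay U {0..int n})"

definition endpoint_index :: "'a set \<Rightarrow> nat \<Rightarrow> nat"
  where "endpoint_index U n = subgroup_index G U (stay U {0, int n})"

text \<open>The step indices decrease, so their infimum is also their eventual value, and the orbit
  index grows like its powers.\<close>

definition growth_rate :: "'a set \<Rightarrow> nat"
  where "growth_rate U = (INF n. step_index U n)"

lemma step_index_antimono:
  assumes U: "U \<in> compact_open_subgroups G T"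
  shows "antimono (step_index U)"
  unfolding decseq_Suc_iff
proof
  fix n
  have un: "{0..int (Suc n)} \<union> {int n + 2} = {0..int (Suc n) + 1}"
    "{1..int (Suc n)} \<union> {int n + 2} = {1..int n + 2}"
    by auto
  have "step_index U (Suc n) \<le> subgroup_index G (stay U {1..int (Suc n)}) (stay U {1..int n + 2})"
    using index_stay_le[OF U, of "{0..int (Suc n)}" "{1..int (Suc n)}" "{int n + 2}"]
    unfolding un step_index_def by simp
  also have "\<dots> = step_index U n"
    using index_stay_shift[of U 1 "{1..int (Suc n)}" "{1..int n + 2}"]
    by (simp add: step_index_def image_minus_const_atLeastAtMost' algebra_simps)
  finally show "step_index U (Suc n) \<le> step_index U n" .
qed

text \<open>Thus passing from \<open>U\<close> to \<open>stay U {0..n}\<close> lowers the displacement index from the initial value of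
  the decreasing sequence of step indices to its \<open>n\<close>-th value.\<close>

lemma scale_at_stay: "scale_at G \<phi> (stay U {0..int n}) = step_index U n"
proof -
  have im: "\<phi> ` stay U {0..int n} = stay U {-1..int n - 1}"
    using iter_image_stay[of 1 U "{0..int n}"] by (simp add: iter_1 image_minus_const_atLeastAtMost')
  have "{0..int n} \<union> {-1..int n - 1} = {-1..int n}"
    by auto
  then have "stay U {0..int n} \<inter> stay U {-1..int n - 1} = stay U {-1..int n}"
    by (simp flip: stay_Un)
  then have "scale_at G \<phi> (stay U {0..int n}) =
      subgroup_index G (stay U {-1..int n - 1}) (stay U {-1..int n})"
    by (simp add: scale_at_def im)
  also have "\<dots> = step_index U n"
    using index_stay_shift[of U "-1" "{-1..int n - 1}" "{-1..int n}"]
    by (simp add: step_index_def image_minus_const_atLeastAtMost')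
  finally show ?thesis .
qed

lemma scale_at_conv_step_index:
  assumes "U \<in> compact_open_subgroups G T"
  shows "scale_at G \<phi> U = step_index U 0"
  using scale_at_stay[of U 0] stay_0 compact_open_subgroupsD(5)[OF assms] by simp

lemma orbit_index_0:
  assumes "U \<in> compact_open_subgroups G T"
  shows "orbit_index U 0 = 1"
  using compact_open_subgroupsD(1,5)[OF assms] by (simp add: orbit_index_def stay_0 subgroup_index_self)

lemma orbit_index_Suc:
  assumes U: "U \<in> compact_open_subgroups G T"
  shows "orbit_index U (Suc n) = orbit_index U n * step_index U n"
  unfolding orbit_index_def step_index_def
  using compact_open_subgroup_index_tower[of "stay U {0..int (Suc n)}" "stay U {0..int n}" U] U
    stay_compact_open_subgroup[OF U] stay_subset[of "{0..int n}" U]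
    stay_antimono[of "{0..int n}" "{0..int (Suc n)}" U]
  by (simp add: algebra_simps)

lemma step_index_pos:
  assumes "U \<in> compact_open_subgroups G T"
  shows "step_index U n > 0"
  using stay_compact_open_subgroup[OF assms] by (simp add: step_index_def subgroup_index_pos)

lemma growth_rate_le: "growth_rate U \<le> step_index U n"
  unfolding growth_rate_def by (rule cINF_lower) auto

lemma growth_rate_attained:
  assumes U: "U \<in> compact_open_subgroups G T"
  obtains N where "\<And>n. n \<ge> N \<Longrightarrow> step_index U n = growth_rate U"
proof -
  obtain N where N: "step_index U N = growth_rate U"
    using Inf_nat_def1[of "range (step_index U)"] by (auto simp: growth_rate_def)
  have "step_index U n = growth_rate U" if "n \<ge> N" for n
    using antimonoD[OF step_index_antimono[OF U] that] N growth_rate_le[of U n] by simp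
  then show ?thesis
    using that by blast
qed

lemma growth_rate_power_le:
  assumes U: "U \<in> compact_open_subgroups G T"
  shows "growth_rate U ^ n \<le> orbit_index U n"
proof (induction n)
  case (Suc n)
  then show ?case
    using mult_le_mono[OF Suc growth_rate_le[of U n]] by (simp add: orbit_index_Suc[OF U] mult.commute)
qed (simp add: orbit_index_0[OF U])

lemma orbit_index_le_power:
  assumes U: "U \<in> compact_open_subgroups G T"
  shows "orbit_index U n \<le> step_index U 0 ^ n"
proof (induction n)
  case (Suc n)
  have "step_index U n \<le> step_index U 0"
    using antimonoD[OF step_index_antimono[OF U]] by blast
  then show ?case
    using mult_le_mono[OF Suc \<open>step_index U n \<le> step_index U 0\<close>]
    by (simp add: orbit_index_Suc[OF U] mult.commute)
qed (simp add: orbit_index_0[OF U])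

lemma neg_cotrajectory_eq_stay:
  assumes U: "U \<subseteq> carrier G"
  shows "neg_cotrajectory G \<phi> U n = stay U {0..int n}"
proof -
  have "\<Phi> k ` U = stay U {- k}" for k
    using iter_image_stay[of k U "{0}"] stay_0[OF U] by simp
  then have "neg_cotrajectory G \<phi> U n = (\<Inter>k\<in>{- int n..0}. stay U {- k})"
    by (simp add: neg_cotrajectory_def)
  also have "\<dots> = stay U {0..int n}"
  proof (intro Set.set_eqI iffI)
    fix x assume x: "x \<in> (\<Inter>k\<in>{- int n..0}. stay U {- k})"
    then have "x \<in> stay U {- (- k)}" if "k \<in> {0..int n}" for k
      using that by (intro INT_D[OF x]) auto
    then show "x \<in> stay U {0..int n}"
      by (force simp: stay_def)
  qed (auto simp: stay_def)
  finally show ?thesis .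
qed

text \<open>From some \<open>N\<close> on the step indices have the constant value \<open>growth_rate U\<close>, so the orbit index is a
  geometric progression from there.\<close>

lemma top_entropy_at_eq:
  assumes U: "U \<in> compact_open_subgroups G T"
  shows "top_entropy_at G \<phi> U = ln (real (growth_rate U))"
proof -
  let ?\<alpha> = "growth_rate U"
  obtain N where N: "\<And>n. n \<ge> N \<Longrightarrow> step_index U n = ?\<alpha>"
    using growth_rate_attained[OF U] by blast
  have pos: "real ?\<alpha> > 0" "real (orbit_index U N) > 0"
    using N[of N] step_index_pos[OF U, of N] subgroup_index_pos[OF U]
      stay_compact_open_subgroup[OF U] by (simp_all add: orbit_index_def)
  have orb: "orbit_index U (N + m) = orbit_index U N * ?\<alpha> ^ m" for m
    by (induction m) (simp_all add: orbit_index_Suc[OF U] N)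
  have eq: "ln (real (orbit_index U n)) / real n =
      (ln (real (orbit_index U N)) - real N * ln (real ?\<alpha>)) / real n + ln (real ?\<alpha>)"
    if n: "n \<ge> N" "n > 0" for n
  proof -
    obtain m where m: "n = N + m"
      using n(1) le_Suc_ex by blast
    have "ln (real (orbit_index U n)) = ln (real (orbit_index U N)) + real m * ln (real ?\<alpha>)"
      using pos by (simp add: m orb ln_mult ln_realpow)
    then have "ln (real (orbit_index U n)) =
        ln (real (orbit_index U N)) - real N * ln (real ?\<alpha>) + ln (real ?\<alpha>) * real n"
      by (simp add: m algebra_simps)
    then show ?thesis
      using n(2) by (simp add: divide_add_eq_iff)
  qed
  have "eventually (\<lambda>n. (ln (real (orbit_index U N)) - real N * ln (real ?\<alpha>)) / real n + ln (real ?\<alpha>) =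
      ln (real (orbit_index U n)) / real n) sequentially"
    using eventually_ge_at_top[of "max N 1"] by eventually_elim (simp add: eq)
  moreover have "(\<lambda>n. (ln (real (orbit_index U N)) - real N * ln (real ?\<alpha>)) / real n + ln (real ?\<alpha>))
      \<longlonglongrightarrow> 0 + ln (real ?\<alpha>)"
    by (intro tendsto_add lim_const_over_n tendsto_const)
  ultimately have "(\<lambda>n. ln (real (orbit_index U n)) / real n) \<longlonglongrightarrow> ln (real ?\<alpha>)"
    by (simp add: Lim_transform_eventually)
  then show ?thesis
    unfolding top_entropy_at_def neg_cotrajectory_eq_stay[OF compact_open_subgroupsD(5)[OF U]]
    by (simp add: orbit_index_def limI)
qed

lemma scale_le_step_index:
  assumes "U \<in> compact_open_subgroups G T"
  shows "scale G T \<phi> \<le> step_index U n"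
proof -
  have "stay U {0..int n} \<in> compact_open_subgroups G T"
    using assms by (intro stay_compact_open_subgroup) auto
  then show ?thesis
    unfolding scale_def by (intro Least_le) (metis scale_at_stay)
qed

lemma scale_le_growth_rate:
  assumes "U \<in> compact_open_subgroups G T"
  shows "scale G T \<phi> \<le> growth_rate U"
  using growth_rate_attained[OF assms] scale_le_step_index[OF assms] by (metis order_refl)

lemma minimizing_exists: "\<exists>U. minimizing G T \<phi> U"
proof -
  obtain V where "V \<in> compact_open_subgroups G T"
    using compact_open_subgroup_exists by blast
  then have "\<exists>U\<in>compact_open_subgroups G T. scale G T \<phi> = scale_at G \<phi> U"
    unfolding scale_def
    by (intro LeastI[of "\<lambda>n. \<exists>U\<in>compact_open_subgroups G T. n = scale_at G \<phi> U" "scale_at G \<phi> V"]) blast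
  then show ?thesis
    by (auto simp: minimizing_def)
qed

lemma scale_pos: "scale G T \<phi> > 0"
proof -
  obtain U where "U \<in> compact_open_subgroups G T" "scale_at G \<phi> U = scale G T \<phi>"
    using minimizing_exists by (auto simp: minimizing_def)
  then show ?thesis
    using scale_at_conv_step_index step_index_pos by metis
qed

lemma minimizing_stay_if_growth_rate:
  assumes U: "U \<in> compact_open_subgroups G T" and "growth_rate U = scale G T \<phi>"
  obtains n where "minimizing G T \<phi> (stay U {0..int n})"
proof -
  obtain n where "step_index U n = scale G T \<phi>"
    using growth_rate_attained[OF U] assms(2) by (metis order_refl)
  then show ?thesis
    using stay_compact_open_subgroup[OF U, of "{0..int n}"] scale_at_stay[of U n]
    by (intro that) (simp add: minimizing_def)
qed

lemma orbit_index_subset_le: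
  assumes U: "U \<in> compact_open_subgroups G T" and V: "V \<in> compact_open_subgroups G T" and "V \<subseteq> U"
  shows "orbit_index U n \<le> subgroup_index G U V * orbit_index V n"
proof -
  have s: "stay U {0..int n} \<in> compact_open_subgroups G T" "stay V {0..int n} \<in> compact_open_subgroups G T"
    using stay_compact_open_subgroup U V by auto
  have "orbit_index U n \<le> subgroup_index G U (stay V {0..int n})"
    unfolding orbit_index_def using assms s stay_mono[of V U] stay_subset[of "{0..int n}" U]
    by (intro compact_open_subgroup_index_mono) auto
  also have "\<dots> = subgroup_index G U V * orbit_index V n"
    unfolding orbit_index_def using assms s stay_subset[of "{0..int n}" V]
    by (intro compact_open_subgroup_index_tower) auto
  finally show ?thesis .
qed

lemma endpoint_index_le_orbit_index:
  assumes U: "U \<in> compact_open_subgroups G T"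
  shows "endpoint_index U n \<le> orbit_index U n"
  unfolding endpoint_index_def orbit_index_def
  using stay_compact_open_subgroup[OF U] U stay_subset[of "{0, int n}" U]
    stay_antimono[of "{0, int n}" "{0..int n}" U]
  by (intro compact_open_subgroup_index_mono) auto

text \<open>Also constraining the intermediate time \<open>m\<close> only increases the index, and then the
  parts of the segment before and after \<open>m\<close> are estimated separately.\<close>

lemma endpoint_index_add_le:
  assumes U: "U \<in> compact_open_subgroups G T"
  shows "endpoint_index U (m + n) \<le> endpoint_index U m * endpoint_index U n"
proof -
  note cos = stay_compact_open_subgroup[OF U]
  have sub: "stay U {0} = U"
    using stay_0 compact_open_subgroupsD(5)[OF U] by blast
  have "endpoint_index U (m + n) \<le> subgroup_index G U (stay U ({0, int m} \<union> {int m + int n}))"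
    unfolding endpoint_index_def using cos U stay_subset[of "{0, int (m + n)}" U]
    by (intro compact_open_subgroup_index_mono stay_antimono) auto
  also have "\<dots> = endpoint_index U m *
      subgroup_index G (stay U {0, int m}) (stay U ({0, int m} \<union> {int m + int n}))"
    unfolding endpoint_index_def using cos U stay_subset[of "{0, int m}" U]
    by (intro compact_open_subgroup_index_tower stay_antimono) auto
  also have "subgroup_index G (stay U {0, int m}) (stay U ({0, int m} \<union> {int m + int n})) \<le>
      subgroup_index G (stay U {int m}) (stay U ({int m} \<union> {int m + int n}))"
    by (intro index_stay_le[OF U]) auto
  also have "\<dots> = endpoint_index U n"
    using index_stay_shift[of U "int m" "{int m}" "{int m} \<union> {int m + int n}"]
    by (simp add: endpoint_index_def sub insert_commute)
  finally show ?thesis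
    by simp
qed

lemma endpoint_index_mult_le:
  assumes U: "U \<in> compact_open_subgroups G T"
  shows "endpoint_index U (n * k) \<le> endpoint_index U n ^ k"
proof (induction k)
  case 0
  show ?case
    using U endpoint_index_le_orbit_index[OF U, of 0] by (simp add: orbit_index_0)
next
  case (Suc k)
  have "endpoint_index U (n * Suc k) \<le> endpoint_index U n * endpoint_index U (n * k)"
    using endpoint_index_add_le[OF U, of n "n * k"] by simp
  also have "\<dots> \<le> endpoint_index U n ^ Suc k"
    using Suc by simp
  finally show ?case .
qed

text \<open>Shrinking \<open>U\<close> to \<open>U \<inter> W\<close> or enlarging \<open>U \<inter> W\<close> to \<open>W\<close> changes the conditions at two times only, and
  each change costs a bounded factor. For orbit indices this fails: there the number of
  conditions grows with \<open>n\<close>.\<close>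

lemma endpoint_index_compare:
  assumes U: "U \<in> compact_open_subgroups G T" and W: "W \<in> compact_open_subgroups G T"
  obtains C where "\<And>n. endpoint_index U n \<le> C * endpoint_index W n"
proof -
  define Q where "Q = U \<inter> W"
  have Q: "Q \<in> compact_open_subgroups G T" "Q \<subseteq> U" "Q \<subseteq> W"
    using Int_compact_open_subgroups[OF U W] by (auto simp: Q_def)
  have s0: "stay V {0} = V" if "V \<in> compact_open_subgroups G T" for V
    using stay_0 compact_open_subgroupsD(5)[OF that] by blast
  show ?thesis
  proof (rule that)
    fix n
    let ?n = "int n"
    have cos: "stay U {0, ?n} \<in> compact_open_subgroups G T" "stay Q {0, ?n} \<in> compact_open_subgroups G T"
        "stay Q {?n} \<in> compact_open_subgroups G T" "stay W {?n} \<in> compact_open_subgroups G T"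
      using U W Q(1) by (simp_all add: stay_compact_open_subgroup)
    have QW: "Q \<inter> stay W {?n} \<in> compact_open_subgroups G T"
        "W \<inter> stay W {?n} \<in> compact_open_subgroups G T"
      using Int_compact_open_subgroups[OF _ cos(4)] Q(1) W by blast+
    have split: "stay V {0, ?n} = V \<inter> stay V {?n}" if "V \<in> compact_open_subgroups G T" for V
      using stay_Un[of V "{0}" "{?n}"] s0[OF that] by (simp add: insert_commute)
    have eq: "stay Q {0, ?n} = (Q \<inter> stay W {?n}) \<inter> stay Q {?n}"
      using stay_mono[OF Q(3), of "{?n}"] split[OF Q(1)] by blast
    have 1: "endpoint_index U n \<le> subgroup_index G U (stay Q {0, ?n})"
      unfolding endpoint_index_def using cos U stay_subset[of "{0, ?n}" U] stay_mono[OF Q(2)]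
      by (intro compact_open_subgroup_index_mono) auto
    have 2: "subgroup_index G U (stay Q {0, ?n}) =
        subgroup_index G U Q * subgroup_index G Q (stay Q {0, ?n})"
      using cos U Q stay_subset[of "{0, ?n}" Q] by (intro compact_open_subgroup_index_tower) auto
    have 3: "subgroup_index G Q (stay Q {0, ?n}) =
        subgroup_index G Q (Q \<inter> stay W {?n}) * subgroup_index G (Q \<inter> stay W {?n}) (stay Q {0, ?n})"
      using eq by (intro compact_open_subgroup_index_tower cos QW Q(1)) auto
    have "Q \<inter> (W \<inter> stay W {?n}) = Q \<inter> stay W {?n}"
      using Q(3) by blast
    then have 4: "subgroup_index G Q (Q \<inter> stay W {?n}) \<le> endpoint_index W n"
      using compact_open_subgroup_index_Int_le[OF QW(2) Q(1) W Q(3)]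
      by (simp add: endpoint_index_def split[OF W])
    have 5: "subgroup_index G (Q \<inter> stay W {?n}) (stay Q {0, ?n}) \<le>
        subgroup_index G (stay W {?n}) (stay Q {?n})"
      unfolding eq by (intro compact_open_subgroup_index_Int_le cos QW) auto
    have 6: "subgroup_index G (stay W {?n}) (stay Q {?n}) = subgroup_index G W Q"
      using iter_image_stay[of "- ?n" W "{0}"]
        iter_image_stay[of "- ?n" Q "{0}"] s0[OF W] s0[OF Q(1)]
        subgroup_index_image[OF iter_hom[of "- ?n"] iter_inj, of W Q]
        compact_open_subgroupsD(5)[OF W] compact_open_subgroupsD(5)[OF Q(1)] by simp
    have "endpoint_index U n \<le> subgroup_index G U Q * (endpoint_index W n * subgroup_index G W Q)"
      using 1 unfolding 2 3 by (rule order_trans) (use 4 5 6 in \<open>auto intro!: mult_le_mono\<close>)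
    then show "endpoint_index U n \<le> subgroup_index G U Q * subgroup_index G W Q * endpoint_index W n"
      by (simp add: ac_simps)
  qed
qed

end

section \<open>Capturing orbit segments\<close>

context tdlc_automorphism
begin

text \<open>With constant step indices, \<open>stay U {-n..0}\<close> has as many cosets modulo \<open>stay U {-n..n}\<close> as \<open>U\<close> has
  modulo \<open>stay U {0..n}\<close>, namely \<open>step_index U 0 ^ n\<close>; equality of the two indices means that the two
  groups have product \<open>U\<close>.\<close>

lemma stay_decomposition_finite:
  assumes U: "U \<in> compact_open_subgroups G T"
    and const: "\<And>n. step_index U n = step_index U 0"
    and x: "x \<in> U"
  shows "\<exists>y\<in>stay U {0..int n}. \<exists>z\<in>stay U {- int n..0}. x = y \<otimes> z"
proof -
  let ?a = "step_index U 0"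
  let ?K = "stay U {0..int n}" and ?H = "stay U {- int n..0}"
  note cos = stay_compact_open_subgroup[OF U]
  have KH: "?K \<in> compact_open_subgroups G T" "?H \<in> compact_open_subgroups G T"
    "stay U {0..int (n + n)} \<in> compact_open_subgroups G T"
    by (rule cos; simp)+
  have orb: "orbit_index U m = ?a ^ m" for m
  proof (induction m)
    case (Suc m)
    then show ?case
      using orbit_index_Suc[OF U, of m] const[of m] by simp
  qed (simp add: orbit_index_0[OF U])
  have "{- int n..0} \<union> {0..int n} = {- int n..int n}"
    by auto
  then have "?H \<inter> ?K = stay U {- int n..int n}"
    by (simp flip: stay_Un)
  then have "subgroup_index G ?H (?H \<inter> ?K) = subgroup_index G ?K (stay U {0..int (n + n)})"
    using index_stay_shift[of U "- int n" "{- int n..0}" "{- int n..int n}"]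
    by (simp add: image_minus_const_atLeastAtMost')
  moreover have "orbit_index U (n + n) = orbit_index U n * subgroup_index G ?K (stay U {0..int (n + n)})"
    unfolding orbit_index_def using stay_subset[of "{0..int n}" U]
    by (intro compact_open_subgroup_index_tower KH U stay_antimono) auto
  ultimately have "subgroup_index G ?H (?H \<inter> ?K) = ?a ^ n"
    using step_index_pos[OF U, of 0] by (simp add: orb power_add)
  then have le: "subgroup_index G U ?K \<le> subgroup_index G ?H (?H \<inter> ?K)"
    using orb[of n] by (simp add: orbit_index_def)
  have fin: "finite ((\<lambda>x. ?K #> x) ` U)"
    using finite_rcosets_of_open_subgroup[OF compact_open_subgroupsD(2)[OF U]
        compact_open_subgroupsD(1,3)[OF KH(1)]] .
  have "?H \<subseteq> U"
    by (rule stay_subset) simp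
  then obtain k h where "k \<in> ?K" "h \<in> ?H" "x = k \<otimes> h"
    by (rule factorization_of_subgroup_index_Int_eq[OF compact_open_subgroupsD(1)[OF KH(1)]
        compact_open_subgroupsD(1)[OF KH(2)] compact_open_subgroupsD(1)[OF U] _ fin le x])
  then show ?thesis
    by blast
qed

text \<open>The factorization \<open>U = U\<^sub>- U\<^sub>+\<close> (\<open>U\<close> is tidy above). For fixed \<open>x\<close> the possible left factors in
  the finite decompositions form a decreasing sequence of nonempty closed subsets of the compact
  set \<open>U\<close>, and a common point of these sets works for all times at once.\<close>

lemma stay_decomposition:
  assumes U: "U \<in> compact_open_subgroups G T"
    and const: "\<And>n. step_index U n = step_index U 0"
    and x: "x \<in> U"
  obtains y z where "y \<in> stay U {0..}" "z \<in> stay U {..0}" "x = y \<otimes> z"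
proof -
  note D = compact_open_subgroupsD[OF U]
  have xc: "x \<in> carrier G"
    using x D(5) by blast
  define C where "C n = {y \<in> stay U {0..int n}. inv y \<otimes> x \<in> stay U {- int n..0}}" for n
  have C_alt: "C n = stay U {0..int n} \<inter> {y \<in> topspace T. inv y \<otimes> x \<in> stay U {- int n..0}}" for n
    by (auto simp: C_def stay_def topspace_eq)
  have sub: "C n \<subseteq> U" for n
    unfolding C_def using stay_subset[of "{0..int n}" U] by auto
  have closed: "closedin (subtopology T U) (C n)" for n
  proof (rule closedin_subset_topspace)
    have "continuous_map T T (\<lambda>y. inv y \<otimes> x)"
      using xc continuous_inv by (intro continuous_intros) auto
    then have "closedin T {y \<in> topspace T. inv y \<otimes> x \<in> stay U {- int n..0}}"
      by (rule closedin_continuous_map_preimage) (simp add: closedin_stay D(4))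
    then show "closedin T (C n)"
      unfolding C_alt by (intro closedin_Int closedin_stay D(4)) auto
  qed (rule sub)
  have nonempty: "C n \<noteq> {}" for n
  proof -
    obtain y z where yz: "y \<in> stay U {0..int n}" "z \<in> stay U {- int n..0}" "x = y \<otimes> z"
      using stay_decomposition_finite[OF U const x] by blast
    then have "inv y \<otimes> x = z"
      by (simp add: stay_def flip: m_assoc)
    then show ?thesis
      using yz by (auto simp: C_def)
  qed
  have "decseq C"
    unfolding decseq_Suc_iff C_def stay_def by auto
  then have "(\<Inter>n. C n) \<noteq> {}"
    using closed nonempty D(2) by (intro compact_space_imp_nest[of "subtopology T U"])
      (auto simp: compact_space_subtopology)
  then obtain y where y: "\<And>n. y \<in> C n"
    by blast
  have "y \<in> stay U {0..}"
  proof -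
    have "\<Phi> k y \<in> U" if "k \<ge> 0" for k
      using y[of "nat k"] that by (simp add: C_def stay_def)
    then show ?thesis
      using y[of 0] by (simp add: C_def stay_def)
  qed
  moreover have "inv y \<otimes> x \<in> stay U {..0}"
  proof -
    have "\<Phi> k (inv y \<otimes> x) \<in> U" if "k \<le> 0" for k
      using y[of "nat (- k)"] that by (simp add: C_def stay_def)
    then show ?thesis
      using y[of 0] by (simp add: C_def stay_def)
  qed
  moreover have "x = y \<otimes> (inv y \<otimes> x)"
    using y[of 0] xc by (simp add: C_def stay_def flip: m_assoc)
  ultimately show ?thesis
    using that by blast
qed

text \<open>The points whose orbit leaves \<open>U\<close> only during a bounded span of time. They are the obstruction
  to tidiness below: such an orbit may start and end in \<open>U\<close> while wandering off in between.\<close>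

definition bounded_core :: "'a set \<Rightarrow> 'a set"
  where "bounded_core U = {x \<in> carrier G. \<exists>N. \<forall>k. \<bar>k\<bar> \<ge> N \<longrightarrow> \<Phi> k x \<in> U}"

lemma subgroup_bounded_core:
  assumes U: "subgroup U G"
  shows "subgroup (bounded_core U) G"
proof
  show "x \<otimes> y \<in> bounded_core U" if x: "x \<in> bounded_core U" and y: "y \<in> bounded_core U" for x y
  proof -
    obtain M N where "\<And>k. \<bar>k\<bar> \<ge> M \<Longrightarrow> \<Phi> k x \<in> U" "\<And>k. \<bar>k\<bar> \<ge> N \<Longrightarrow> \<Phi> k y \<in> U"
      using x y by (auto simp: bounded_core_def)
    then have "\<forall>k. \<bar>k\<bar> \<ge> max M N \<longrightarrow> \<Phi> k (x \<otimes> y) \<in> U"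
      using x y subgroup.m_closed[OF U] by (auto simp: bounded_core_def iter_mult)
    then show ?thesis
      using x y unfolding bounded_core_def by blast
  qed
  show "inv x \<in> bounded_core U" if "x \<in> bounded_core U" for x
    using that subgroup.m_inv_closed[OF U] by (auto simp: bounded_core_def iter_inv)
qed (use subgroup.one_closed[OF U] in \<open>auto simp: bounded_core_def\<close>)

lemma bounded_core_mono: "U \<subseteq> V \<Longrightarrow> bounded_core U \<subseteq> bounded_core V"
  unfolding bounded_core_def by blast

lemma iter_bounded_core:
  assumes "x \<in> bounded_core U"
  shows "\<Phi> j x \<in> bounded_core U"
proof -
  obtain N where x: "x \<in> carrier G" and N: "\<And>k. \<bar>k\<bar> \<ge> N \<Longrightarrow> \<Phi> k x \<in> U"
    using assms by (auto simp: bounded_core_def)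
  have "\<Phi> k (\<Phi> j x) \<in> U" if "\<bar>k\<bar> \<ge> N + \<bar>j\<bar>" for k
    using N[of "k + j"] that x by (simp add: iter_add)
  then show ?thesis
    using x by (auto simp: bounded_core_def)
qed

text \<open>Let \<open>L\<close> be the bounded core and \<open>L\<^sub>+ = L \<inter> stay U {..0}\<close>. Only finitely many \<open>U\<close>-cosets meet
  \<open>\<Phi> 1 ` L\<^sub>+\<close>, and representatives of them can be chosen in \<open>L\<close>; finitely many elements of \<open>L\<close> return to \<open>U\<close>
  for good at a common time \<open>N\<close>. Applying \<open>\<Phi> 1\<close> once more to an element of \<open>L\<^sub>+\<close> splits off one
  representative, which after time \<open>N\<close> contributes just a factor in \<open>U\<close>. Hence the elements of \<open>L\<close>, all
  of which are images of elements of \<open>L\<^sub>+\<close> under high iterates, stay in the compact set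
  \<open>\<Phi> N ` U <#> U\<close>.\<close>

lemma bounded_core_subset_compact:
  assumes U: "U \<in> compact_open_subgroups G T"
  obtains K where "compactin T K" "bounded_core U \<subseteq> K"
proof -
  note D = compact_open_subgroupsD[OF U]
  define L where "L = bounded_core U"
  define M where "M = L \<inter> stay U {..-1}"
  have sL: "subgroup L G"
    unfolding L_def by (rule subgroup_bounded_core[OF D(1)])
  have sM: "subgroup M G"
    unfolding M_def by (intro subgroups_Inter_pair sL subgroup_stay D(1))
  have "M \<subseteq> stay U {..-1}"
    by (auto simp: M_def)
  then have "finite ((\<lambda>x. U #> x) ` M)"
    using finite_rcosets_of_open_subgroup[OF compactin_stay[OF U, of "{..-1}"] D(1,3)]
    by (auto intro: finite_subset[OF image_mono])
  then obtain R where R: "R \<subseteq> M" "finite R" "(\<lambda>x. U #> x) ` M = (\<lambda>x. U #> x) ` R"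
    using finite_subset_image[of "(\<lambda>x. U #> x) ` M" "\<lambda>x. U #> x" M] by auto
  have "\<exists>n::nat. \<forall>k\<ge>int n. \<Phi> k x \<in> U" if "x \<in> L" for x
  proof -
    obtain N where "\<And>k. \<bar>k\<bar> \<ge> N \<Longrightarrow> \<Phi> k x \<in> U"
      using \<open>x \<in> L\<close> by (auto simp: L_def bounded_core_def)
    then show ?thesis
      by (intro exI[of _ "nat N"]) auto
  qed
  then obtain m :: "'a \<Rightarrow> nat" where m: "\<And>x k. x \<in> L \<Longrightarrow> k \<ge> int (m x) \<Longrightarrow> \<Phi> k x \<in> U"
    by metis
  define N where "N = Max (insert 0 (m ` R))"
  have N: "\<Phi> k x \<in> U" if "x \<in> R" "k \<ge> int N" for x k
  proof -
    have "m x \<le> N"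
      using R(2) that(1) by (simp add: N_def)
    then show ?thesis
      using that R(1) by (intro m) (auto simp: M_def)
  qed
  \<comment> \<open>However long the iteration, all but \<open>N\<close> of its steps can be absorbed in the factor \<open>u\<close>.\<close>
  have pull: "\<exists>l'\<in>U. \<exists>u\<in>U. \<Phi> (int N + int n) l = \<Phi> (int N) l' \<otimes> u"
    if "l \<in> L \<inter> stay U {..0}" for l n
    using that
  proof (induction n arbitrary: l)
    case 0
    then have "l \<in> U" "l \<in> carrier G"
      using stay_subset[of "{..0}" U] by (auto simp: stay_def)
    then show ?case
      using D(6) by (intro bexI[of _ l] bexI[of _ \<one>]) auto
  next
    case (Suc n)
    have lc: "l \<in> carrier G"
      using Suc.prems by (simp add: stay_def)
    have "\<Phi> k (\<Phi> 1 l) \<in> U" if "k \<le> -1" for k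
    proof -
      have "\<Phi> (k + 1) l \<in> U"
        using Suc.prems that by (simp add: stay_def)
      then show ?thesis
        using lc by (simp add: iter_add)
    qed
    then have "\<Phi> 1 l \<in> M"
      using Suc.prems lc iter_bounded_core by (simp add: M_def L_def stay_def)
    moreover from this obtain x where x: "x \<in> R" "U #> \<Phi> 1 l = U #> x"
      using R(3) by (metis (no_types, lifting) image_iff)
    moreover have xc: "x \<in> carrier G"
      using x(1) R(1) subgroup.mem_carrier[OF sM] by blast
    ultimately have w: "\<Phi> 1 l \<otimes> inv x \<in> U" "\<Phi> 1 l \<otimes> inv x \<in> M"
      using rcoset_eq_iff[OF D(1), of "\<Phi> 1 l" x] lc R(1)
        subgroup.m_closed[OF sM _ subgroup.m_inv_closed[OF sM]] by auto
    have "\<Phi> k (\<Phi> 1 l \<otimes> inv x) \<in> U" if "k \<le> 0" for k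
      using w that by (cases "k = 0") (simp_all add: M_def stay_def)
    then have "\<Phi> 1 l \<otimes> inv x \<in> L \<inter> stay U {..0}"
      using w(2) by (simp add: M_def stay_def)
    then obtain l' u where lu: "l' \<in> U" "u \<in> U"
      "\<Phi> (int N + int n) (\<Phi> 1 l \<otimes> inv x) = \<Phi> (int N) l' \<otimes> u"
      using Suc.IH by blast
    have "\<Phi> (int N + int (Suc n)) l = \<Phi> (int N + int n) (\<Phi> 1 l)"
      using lc iter_add[of l "int N + int n" 1] by (simp add: algebra_simps)
    also have "\<Phi> 1 l = (\<Phi> 1 l \<otimes> inv x) \<otimes> x"
      using lc xc by (simp add: m_assoc)
    also have "\<Phi> (int N + int n) \<dots> = (\<Phi> (int N) l' \<otimes> u) \<otimes> \<Phi> (int N + int n) x"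
      using lc xc by (subst iter_mult) (simp_all add: lu(3))
    also have "\<dots> = \<Phi> (int N) l' \<otimes> (u \<otimes> \<Phi> (int N + int n) x)"
      using lu(1,2) D(5) xc by (intro m_assoc) auto
    finally show ?case
      using lu N[OF x(1), of "int N + int n"] subgroup.m_closed[OF D(1)] by auto
  qed
  show ?thesis
  proof (rule that)
    show "compactin T (\<Phi> (int N) ` U <#> U)"
      by (intro compactin_set_mult image_compactin[OF _ iter_continuous] D(2))
    show "bounded_core U \<subseteq> \<Phi> (int N) ` U <#> U"
    proof
      fix y assume y: "y \<in> bounded_core U"
      then obtain j where yc: "y \<in> carrier G" and j: "\<And>k. \<bar>k\<bar> \<ge> j \<Longrightarrow> \<Phi> k y \<in> U"
        by (auto simp: bounded_core_def)
      define n where "n = nat \<bar>j\<bar>"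
      let ?l = "\<Phi> (- (int N + int n)) y"
      have "\<Phi> k ?l \<in> U" if "k \<le> 0" for k
      proof -
        have "\<Phi> (k + - (int N + int n)) y \<in> U"
          using that by (intro j) (simp add: n_def)
        then show ?thesis
          unfolding iter_add[OF yc] .
      qed
      then have "?l \<in> L \<inter> stay U {..0}"
        using iter_bounded_core[OF y] yc by (simp add: L_def stay_def)
      then obtain l' u where "l' \<in> U" "u \<in> U" "\<Phi> (int N + int n) ?l = \<Phi> (int N) l' \<otimes> u"
        using pull by blast
      then show "y \<in> \<Phi> (int N) ` U <#> U"
        using iter_neg(1)[OF yc, of "int N + int n"] by (auto simp: set_mult_def)
    qed
  qed
qed

text \<open>Take for \<open>W\<close> the intersection of all \<open>L\<close>-conjugates of \<open>U\<close>. It is normalized by \<open>L\<close>, so \<open>W L\<close> is a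
  group, and it is open because by the tube lemma conjugation by elements of the compact set \<open>K\<close>
  maps a common neighbourhood of \<open>\<one>\<close> into \<open>U\<close>.\<close>

lemma normalized_compact_open_subgroup:
  assumes U: "U \<in> compact_open_subgroups G T" and L: "subgroup L G"
    and K: "compactin T K" "L \<subseteq> K"
  obtains W where "W \<in> compact_open_subgroups G T" "W \<subseteq> U"
    "W <#> L \<in> compact_open_subgroups G T"
proof -
  note D = compact_open_subgroupsD[OF U]
  have Lc: "l \<in> carrier G" if "l \<in> L" for l
    using subgroup.mem_carrier[OF L that] .
  let ?P = "{p \<in> topspace (prod_topology T T). fst p \<otimes> snd p \<otimes> inv (fst p) \<in> U}"
  have P: "openin (prod_topology T T) ?P"
    by (intro openin_vimage continuous_intros D(3))
  have "K \<subseteq> carrier G"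
    using compactin_subset_topspace[OF K(1)] by (simp add: topspace_eq)
  then have sub_P: "K \<times> {\<one>} \<subseteq> ?P"
    using D(6) by (auto simp: topspace_eq)
  have one: "compactin T {\<one>}"
    by (simp add: topspace_eq)
  obtain A B where AB: "openin T A" "openin T B" "K \<subseteq> A" "{\<one>} \<subseteq> B" "A \<times> B \<subseteq> ?P"
    by (rule Wallace_theorem_prod_topology[OF K(1) one P sub_P])
  define W where "W = {x \<in> carrier G. \<forall>l\<in>L. l \<otimes> x \<otimes> inv l \<in> U}"
  have sW: "subgroup W G"
  proof
    show "x \<otimes> y \<in> W" if x: "x \<in> W" and y: "y \<in> W" for x y
    proof -
      have "l \<otimes> (x \<otimes> y) \<otimes> inv l = (l \<otimes> x \<otimes> inv l) \<otimes> (l \<otimes> y \<otimes> inv l)" if l: "l \<in> L" for l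
        using x y Lc[OF l] by (simp add: W_def m_assoc inv_solve_left)
      then show ?thesis
        using x y subgroup.m_closed[OF D(1)] by (simp add: W_def)
    qed
    show "inv x \<in> W" if x: "x \<in> W" for x
    proof -
      have "l \<otimes> inv x \<otimes> inv l = inv (l \<otimes> x \<otimes> inv l)" if l: "l \<in> L" for l
        using x Lc[OF l] by (simp add: W_def inv_mult_group m_assoc)
      then show ?thesis
        using x subgroup.m_inv_closed[OF D(1)] by (simp add: W_def)
    qed
  qed (use Lc D(6) in \<open>auto simp: W_def\<close>)
  have B_sub: "B \<subseteq> W"
  proof
    fix b assume b: "b \<in> B"
    then have "(l, b) \<in> ?P" if "l \<in> L" for l
      using that AB K(2) by blast
    then show "b \<in> W"
      using b openin_subset[OF AB(2)] by (auto simp: W_def topspace_eq)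
  qed
  have open_W: "openin T W"
    by (rule openin_subgroupI[OF sW AB(2) _ B_sub]) (use AB(4) in simp)
  have WU: "W \<subseteq> U"
  proof
    fix w assume "w \<in> W"
    then have "\<one> \<otimes> w \<otimes> inv \<one> \<in> U" "w \<in> carrier G"
      using subgroup.one_closed[OF L] unfolding W_def by blast+
    then show "w \<in> U"
      by simp
  qed
  have W: "W \<in> compact_open_subgroups G T"
    by (rule compact_open_subgroups_subset[OF U sW open_W WU])
  have conj: "l \<otimes> w \<otimes> inv l \<in> W" if l: "l \<in> L" and w: "w \<in> W" for l w
  proof -
    have wc: "w \<in> carrier G"
      using w by (simp add: W_def)
    have "m \<otimes> (l \<otimes> w \<otimes> inv l) \<otimes> inv m \<in> U" if m: "m \<in> L" for m
    proof -
      have "m \<otimes> (l \<otimes> w \<otimes> inv l) \<otimes> inv m = (m \<otimes> l) \<otimes> w \<otimes> inv (m \<otimes> l)"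
        using Lc l m wc by (simp add: inv_mult_group m_assoc)
      then show ?thesis
        using w subgroup.m_closed[OF L m l] by (simp add: W_def)
    qed
    then show ?thesis
      using Lc[OF l] wc by (simp add: W_def)
  qed
  have Wc: "w \<in> carrier G" if "w \<in> W" for w
    using that by (simp add: W_def)
  have sWL: "subgroup (W <#> L) G"
  proof
    show "W <#> L \<subseteq> carrier G"
      using Wc Lc by (auto simp: set_mult_def)
    show "\<one> \<in> W <#> L"
      using subgroup.one_closed[OF sW] subgroup.one_closed[OF L] unfolding set_mult_def by force
    show "x \<otimes> y \<in> W <#> L" if "x \<in> W <#> L" "y \<in> W <#> L" for x y
    proof -
      obtain w l w' l' where *: "w \<in> W" "l \<in> L" "x = w \<otimes> l" "w' \<in> W" "l' \<in> L" "y = w' \<otimes> l'"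
        using \<open>x \<in> W <#> L\<close> \<open>y \<in> W <#> L\<close> by (auto simp: set_mult_def)
      have "inv l \<otimes> (l \<otimes> l') = l'"
        using * Lc by (simp flip: m_assoc)
      then have "x \<otimes> y = (w \<otimes> (l \<otimes> w' \<otimes> inv l)) \<otimes> (l \<otimes> l')"
        using * Wc Lc by (simp add: m_assoc)
      moreover have "w \<otimes> (l \<otimes> w' \<otimes> inv l) \<in> W" "l \<otimes> l' \<in> L"
        using * conj subgroup.m_closed[OF sW] subgroup.m_closed[OF L] by auto
      ultimately show ?thesis
        unfolding set_mult_def by blast
    qed
    show "inv x \<in> W <#> L" if "x \<in> W <#> L" for x
    proof -
      obtain w l where *: "w \<in> W" "l \<in> L" "x = w \<otimes> l"
        using \<open>x \<in> W <#> L\<close> by (auto simp: set_mult_def)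
      have "inv x = (inv l \<otimes> inv w \<otimes> inv (inv l)) \<otimes> inv l"
        using * Wc Lc by (simp add: inv_mult_group m_assoc)
      moreover have "inv l \<otimes> inv w \<otimes> inv (inv l) \<in> W" "inv l \<in> L"
        using * conj subgroup.m_inv_closed[OF sW] subgroup.m_inv_closed[OF L] by auto
      ultimately show ?thesis
        unfolding set_mult_def by blast
    qed
  qed
  have "W \<subseteq> W <#> L"
  proof
    fix w assume "w \<in> W"
    then have "w = w \<otimes> \<one>"
      using Wc by simp
    then show "w \<in> W <#> L"
      using \<open>w \<in> W\<close> subgroup.one_closed[OF L] unfolding set_mult_def by blast
  qed
  then have open_WL: "openin T (W <#> L)"
    by (rule openin_subgroupI[OF sWL open_W subgroup.one_closed[OF sW]])
  have "W <#> L \<subseteq> W <#> K"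
    using K(2) by (auto simp: set_mult_def)
  then have "compactin T (W <#> L)"
    by (rule closed_compactin[OF compactin_set_mult[OF compact_open_subgroupsD(2)[OF W] K(1)] _
        closedin_open_subgroup[OF sWL open_WL]])
  then have "W <#> L \<in> compact_open_subgroups G T"
    using sWL open_WL by (simp add: compact_open_subgroups_def)
  then show ?thesis
    using that W WU by blast
qed

text \<open>Write \<open>y = a b\<close> with \<open>a\<close> staying in \<open>U\<close> in the future and \<open>b\<close> in the past. As \<open>\<Phi> n y\<close> and \<open>\<Phi> n a\<close> are in
  \<open>U\<close>, so is \<open>\<Phi> n b\<close>; split it in the reverse order, as \<open>v w\<close> with \<open>v\<close> staying in \<open>U\<close> in the past and
  \<open>w\<close> in the future. Then \<open>z = \<Phi> (-n) w\<close> is in \<open>U\<close> from time \<open>n\<close> on by choice of \<open>w\<close>, and up to time \<open>0\<close>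
  because it is the quotient of \<open>b\<close> by \<open>\<Phi> (-n) v\<close>. So \<open>z\<close> is in the bounded core, and between the times
  \<open>0\<close> and \<open>n\<close> the orbit of \<open>y\<close> differs from that of \<open>z\<close> by factors in \<open>U\<close>.\<close>

lemma orbit_segment_in_core_product:
  assumes U: "U \<in> compact_open_subgroups G T"
    and const: "\<And>n. step_index U n = step_index U 0"
  shows "stay U {0, int n} \<subseteq> stay (U <#> bounded_core U) {0..int n}"
proof
  note D = compact_open_subgroupsD[OF U]
  have mult: "x \<otimes> y \<in> U" if "x \<in> U" "y \<in> U" for x y
    using subgroup.m_closed[OF D(1)] that by blast
  have inv_in: "inv x \<in> U" if "x \<in> U" for x
    using subgroup.m_inv_closed[OF D(1)] that by blast
  fix y assume "y \<in> stay U {0, int n}"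
  then have y: "y \<in> carrier G" "y \<in> U" "\<Phi> (int n) y \<in> U"
    by (auto simp: stay_def)
  obtain a b where a: "a \<in> stay U {0..}" and b: "b \<in> stay U {..0}" and yab: "y = a \<otimes> b"
    using stay_decomposition[OF U const y(2)] by blast
  have c: "a \<in> carrier G" "b \<in> carrier G"
    using a b by (auto simp: stay_def)
  have "\<Phi> (int n) b = inv (\<Phi> (int n) a) \<otimes> \<Phi> (int n) y"
    using c by (simp add: yab iter_mult flip: m_assoc)
  moreover have "\<Phi> (int n) a \<in> U"
    using a by (simp add: stay_def)
  ultimately have nb: "\<Phi> (int n) b \<in> U"
    using mult inv_in y(3) by simp
  \<comment> \<open>Decomposing the inverse yields the factors of \<open>\<Phi> n b\<close> in the reverse order.\<close>
  then obtain p q where p: "p \<in> stay U {0..}" and q: "q \<in> stay U {..0}"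
    and pq: "inv (\<Phi> (int n) b) = p \<otimes> q"
    using stay_decomposition[OF U const inv_in[OF nb]] by blast
  have c': "p \<in> carrier G" "q \<in> carrier G"
    using p q by (auto simp: stay_def)
  have "\<Phi> (int n) b = inv (p \<otimes> q)"
    using c pq by (metis inv_inv iter_closed)
  then have "\<Phi> (int n) b = inv q \<otimes> inv p"
    using c' by (simp add: inv_mult_group)
  then have "\<Phi> (- int n) (\<Phi> (int n) b) = \<Phi> (- int n) (inv q) \<otimes> \<Phi> (- int n) (inv p)"
    using c' by (simp add: iter_mult)
  then have b_eq: "b = \<Phi> (- int n) (inv q) \<otimes> \<Phi> (- int n) (inv p)"
    using c by simp
  define z where "z = \<Phi> (- int n) (inv p)"
  have zc: "z \<in> carrier G"
    using c' by (simp add: z_def)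
  have z_fwd: "\<Phi> k z \<in> U" if "k \<ge> int n" for k
  proof -
    have "\<Phi> k z = inv (\<Phi> (k - int n) p)"
      using c' iter_add[of "inv p" k "- int n"] by (simp add: z_def iter_inv)
    then show ?thesis
      using p that inv_in by (simp add: stay_def)
  qed
  have q_bwd: "\<Phi> k (\<Phi> (- int n) (inv q)) \<in> U" if "k \<le> int n" for k
  proof -
    have "\<Phi> k (\<Phi> (- int n) (inv q)) = inv (\<Phi> (k - int n) q)"
      using c' iter_add[of "inv q" k "- int n"] by (simp add: iter_inv)
    then show ?thesis
      using q that inv_in by (simp add: stay_def)
  qed
  have z_bwd: "\<Phi> k z \<in> U" if "k \<le> 0" for k
  proof -
    have "z = inv (\<Phi> (- int n) (inv q)) \<otimes> b"
      using c' zc by (simp add: b_eq z_def flip: m_assoc)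
    then have "\<Phi> k z = inv (\<Phi> k (\<Phi> (- int n) (inv q))) \<otimes> \<Phi> k b"
      using c c' by (simp add: iter_mult iter_inv)
    then show ?thesis
      using q_bwd[of k] b that mult inv_in by (simp add: stay_def)
  qed
  have zL: "z \<in> bounded_core U"
  proof -
    have "\<Phi> k z \<in> U" if "\<bar>k\<bar> \<ge> int n" for k
      using z_fwd[of k] z_bwd[of k] that by (cases "k \<ge> int n") auto
    then show ?thesis
      using zc by (auto simp: bounded_core_def)
  qed
  have "\<Phi> k y \<in> U <#> bounded_core U" if k: "k \<in> {0..int n}" for k
  proof -
    have "\<Phi> k y = \<Phi> k a \<otimes> (\<Phi> k (\<Phi> (- int n) (inv q)) \<otimes> \<Phi> k z)"
      using c c' zc by (simp add: yab b_eq z_def[symmetric] iter_mult)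
    also have "\<dots> = (\<Phi> k a \<otimes> \<Phi> k (\<Phi> (- int n) (inv q))) \<otimes> \<Phi> k z"
      using c c' zc by (simp add: m_assoc)
    finally have "\<Phi> k y = (\<Phi> k a \<otimes> \<Phi> k (\<Phi> (- int n) (inv q))) \<otimes> \<Phi> k z" .
    moreover have "\<Phi> k a \<otimes> \<Phi> k (\<Phi> (- int n) (inv q)) \<in> U"
      using a q_bwd[of k] k mult by (simp add: stay_def)
    ultimately show ?thesis
      using iter_bounded_core[OF zL, of k] unfolding set_mult_def by blast
  qed
  then show "y \<in> stay (U <#> bounded_core U) {0..int n}"
    using y(1) by (simp add: stay_def)
qed

text \<open>Start with any compact open subgroup \<open>E\<close>, let \<open>L\<close> be its bounded core and \<open>W \<subseteq> E\<close> a subgroup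
  normalized by \<open>L\<close>. A late enough \<open>U = stay W {0..N}\<close> has constant step indices, and its bounded core
  is contained in \<open>L\<close>. So the orbit segments with ends in \<open>U\<close> are captured by \<open>V = W L\<close>.\<close>

lemma orbit_segments_captured:
  obtains U V where "U \<in> compact_open_subgroups G T" "V \<in> compact_open_subgroups G T" "U \<subseteq> V"
    "\<And>n. stay U {0, int n} \<subseteq> stay V {0..int n}"
proof -
  obtain E where E: "E \<in> compact_open_subgroups G T"
    using compact_open_subgroup_exists by blast
  obtain K where K: "compactin T K" "bounded_core E \<subseteq> K"
    using bounded_core_subset_compact[OF E] .
  obtain W where W: "W \<in> compact_open_subgroups G T" "W \<subseteq> E"
    and WL: "W <#> bounded_core E \<in> compact_open_subgroups G T"
    using normalized_compact_open_subgroup[OF E subgroup_bounded_core[OF compact_open_subgroupsD(1)[OF E]] K] .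
  obtain N where N: "\<And>n. n \<ge> N \<Longrightarrow> step_index W n = growth_rate W"
    using growth_rate_attained[OF W(1)] by blast
  define U where "U = stay W {0..int N}"
  have U: "U \<in> compact_open_subgroups G T"
    unfolding U_def by (intro stay_compact_open_subgroup W) auto
  have UW: "U \<subseteq> W"
    unfolding U_def by (rule stay_subset) simp
  have shift: "(\<Union>j\<in>{0..m}. {j..int N + j}) = {0..int N + m}" if "m \<ge> 0" for m
  proof (intro Set.set_eqI iffI)
    fix k assume "k \<in> {0..int N + m}"
    then show "k \<in> (\<Union>j\<in>{0..m}. {j..int N + j})"
      using that by (intro UN_I[of "max 0 (k - int N)"]) auto
  qed auto
  have "step_index U n = step_index W (N + n)" for n
    by (simp add: step_index_def U_def stay_stay shift add.assoc)
  then have const: "step_index U n = step_index U 0" for n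
    using N by simp
  have "U <#> bounded_core U \<subseteq> W <#> bounded_core E"
    using UW W(2) bounded_core_mono[of U E] by (auto simp: set_mult_def)
  then have "stay U {0, int n} \<subseteq> stay (W <#> bounded_core E) {0..int n}" for n
    using orbit_segment_in_core_product[OF U const] stay_mono by blast
  moreover have "U \<subseteq> W <#> bounded_core E"
  proof
    fix u assume "u \<in> U"
    then have "u = u \<otimes> \<one>" "u \<in> W"
      using UW compact_open_subgroupsD(5)[OF U] by auto
    moreover have "\<one> \<in> bounded_core E"
      using subgroup_bounded_core compact_open_subgroupsD(1)[OF E] subgroup.one_closed by blast
    ultimately show "u \<in> W <#> bounded_core E"
      unfolding set_mult_def by blast
  qed
  ultimately show ?thesis
    using that U WL by blast
qed

section \<open>Scale, entropy and nub\<close>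

text \<open>For the captured pair \<open>U \<subseteq> V\<close> the orbit index of \<open>V\<close>, which is at least the \<open>n\<close>-th power of the
  scale, is bounded by the endpoint index of \<open>U\<close> up to a constant; and endpoint indices of different
  subgroups are comparable.\<close>

lemma scale_power_le_endpoint_index:
  assumes W: "W \<in> compact_open_subgroups G T"
  obtains C where "\<And>n. scale G T \<phi> ^ n \<le> C * endpoint_index W n"
proof -
  obtain U V where U: "U \<in> compact_open_subgroups G T" and V: "V \<in> compact_open_subgroups G T"
    and UV: "U \<subseteq> V" "\<And>n. stay U {0, int n} \<subseteq> stay V {0..int n}"
    using orbit_segments_captured by blast
  obtain C where C: "\<And>n. endpoint_index U n \<le> C * endpoint_index W n"
    using endpoint_index_compare[OF U W] by blast
  show ?thesis
  proof (rule that)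
    fix n
    have s: "stay U {0, int n} \<in> compact_open_subgroups G T" "stay V {0..int n} \<in> compact_open_subgroups G T"
      by (rule stay_compact_open_subgroup; simp add: U V)+
    have "scale G T \<phi> ^ n \<le> growth_rate V ^ n"
      using scale_le_growth_rate[OF V] by (rule power_mono) simp
    also have "\<dots> \<le> orbit_index V n"
      by (rule growth_rate_power_le[OF V])
    also have "\<dots> \<le> subgroup_index G V (stay U {0, int n})"
      unfolding orbit_index_def
      by (rule compact_open_subgroup_index_mono[OF s V UV(2)]) (rule stay_subset, simp)
    also have "\<dots> = subgroup_index G V U * endpoint_index U n"
      unfolding endpoint_index_def
      by (rule compact_open_subgroup_index_tower[OF s(1) U V _ UV(1)]) (rule stay_subset, simp)
    also have "\<dots> \<le> subgroup_index G V U * (C * endpoint_index W n)"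
      using C by simp
    finally show "scale G T \<phi> ^ n \<le> (subgroup_index G V U * C) * endpoint_index W n"
      by (simp add: mult.assoc)
  qed
qed

lemma le_if_power_le_const_mult_power:
  fixes x y C :: nat
  assumes "\<And>n. x ^ n \<le> C * y ^ n" and "y > 0"
  shows "x \<le> y"
proof (rule ccontr)
  assume "\<not> x \<le> y"
  then have "real x / real y > 1"
    using assms(2) by simp
  then obtain n where "real C < (real x / real y) ^ n"
    using real_arch_pow by blast
  then have "real C * real y ^ n < real x ^ n"
    using assms(2) by (simp add: power_divide field_simps)
  then have "C * y ^ n < x ^ n"
    by (metis of_nat_less_iff of_nat_mult of_nat_power)
  then show False
    using assms(1)[of n] by simp
qed

lemma endpoint_index_pos:
  assumes "U \<in> compact_open_subgroups G T"
  shows "endpoint_index U n > 0"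
  unfolding endpoint_index_def
  by (intro subgroup_index_pos assms stay_compact_open_subgroup) auto

lemma minimizing_orbit_index_le:
  assumes "minimizing G T \<phi> U"
  shows "orbit_index U n \<le> scale G T \<phi> ^ n"
  using assms orbit_index_le_power[of U n] scale_at_conv_step_index[of U]
  by (simp add: minimizing_def)

text \<open>Orbit segments with both ends in \<open>U\<close> lie in \<open>U\<close> entirely. In contrast to being minimizing,
  this is visibly preserved by intersections.\<close>

definition orbit_convex :: "'a set \<Rightarrow> bool"
  where "orbit_convex U \<longleftrightarrow> (\<forall>n. stay U {0, int n} = stay U {0..int n})"

text \<open>The endpoint index is at most the orbit index, which is at most \<open>s ^ n\<close> for the scale \<open>s\<close>. The
  opposite bound \<open>s ^ n \<le> C * endpoint_index W n\<close> holds up to a constant; applying it to the times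
  \<open>n * k\<close> for all \<open>k\<close> removes the constant by submultiplicativity. So the two nested groups have the
  same index in \<open>W\<close>.\<close>

lemma minimizing_imp_orbit_convex:
  assumes min: "minimizing G T \<phi> W"
  shows "orbit_convex W"
  unfolding orbit_convex_def
proof
  fix n
  have W: "W \<in> compact_open_subgroups G T"
    using min by (simp add: minimizing_def)
  obtain C where C: "\<And>m. scale G T \<phi> ^ m \<le> C * endpoint_index W m"
    using scale_power_le_endpoint_index[OF W] by blast
  have "(scale G T \<phi> ^ n) ^ k \<le> C * endpoint_index W n ^ k" for k
  proof -
    have "(scale G T \<phi> ^ n) ^ k \<le> C * endpoint_index W (n * k)"
      using C[of "n * k"] by (simp add: power_mult)
    also have "\<dots> \<le> C * endpoint_index W n ^ k"
      by (intro mult_le_mono2 endpoint_index_mult_le W)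
    finally show ?thesis .
  qed
  then have "scale G T \<phi> ^ n \<le> endpoint_index W n"
    using endpoint_index_pos[OF W] by (rule le_if_power_le_const_mult_power)
  then have le: "orbit_index W n \<le> endpoint_index W n"
    using minimizing_orbit_index_le[OF min, of n] by simp
  have s: "stay W {0, int n} \<in> compact_open_subgroups G T" "stay W {0..int n} \<in> compact_open_subgroups G T"
    by (rule stay_compact_open_subgroup[OF W]; simp)+
  have sub: "stay W {0..int n} \<subseteq> stay W {0, int n}"
    by (rule stay_antimono) auto
  have "stay W {0, int n} \<subseteq> W"
    by (rule stay_subset) simp
  then have "orbit_index W n = endpoint_index W n * subgroup_index G (stay W {0, int n}) (stay W {0..int n})"
    unfolding orbit_index_def endpoint_index_def
    by (rule compact_open_subgroup_index_tower[OF s(2,1) W sub])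
  then have "subgroup_index G (stay W {0, int n}) (stay W {0..int n}) \<le> 1"
    using le endpoint_index_pos[OF W, of n] by simp
  then have "subgroup_index G (stay W {0, int n}) (stay W {0..int n}) = 1"
    using subgroup_index_pos[OF s] by simp
  then show "stay W {0, int n} = stay W {0..int n}"
    using eq_if_subgroup_index_eq_1[OF compact_open_subgroupsD(1)[OF s(2)]
        compact_open_subgroupsD(1)[OF s(1)] sub] by simp
qed

lemma orbit_convex_Inter:
  assumes "\<And>U. U \<in> \<F> \<Longrightarrow> orbit_convex U"
  shows "orbit_convex (\<Inter>\<F>)"
  unfolding orbit_convex_def
proof
  fix n
  have stay_Inter: "stay (\<Inter>\<F>) I = {x \<in> carrier G. \<forall>U\<in>\<F>. x \<in> stay U I}" for I
    by (auto simp: stay_def)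
  show "stay (\<Inter>\<F>) {0, int n} = stay (\<Inter>\<F>) {0..int n}"
    unfolding stay_Inter using assms by (auto simp: orbit_convex_def)
qed

text \<open>For an orbit convex group the orbit index is the endpoint index, which is comparable with that
  of a minimizing subgroup.\<close>

lemma orbit_convex_orbit_index_le:
  assumes V: "V \<in> compact_open_subgroups G T" and "orbit_convex V"
  obtains C where "\<And>n. orbit_index V n \<le> C * scale G T \<phi> ^ n"
proof -
  obtain W where W: "minimizing G T \<phi> W"
    using minimizing_exists by blast
  then have W': "W \<in> compact_open_subgroups G T"
    by (simp add: minimizing_def)
  obtain C where C: "\<And>n. endpoint_index V n \<le> C * endpoint_index W n"
    using endpoint_index_compare[OF V W'] by blast
  show ?thesis
  proof (rule that)
    fix n
    have "orbit_index V n = endpoint_index V n"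
      using assms(2) by (simp add: orbit_index_def endpoint_index_def orbit_convex_def)
    also have "\<dots> \<le> C * endpoint_index W n"
      by (rule C)
    also have "endpoint_index W n \<le> scale G T \<phi> ^ n"
      using endpoint_index_le_orbit_index[OF W'] minimizing_orbit_index_le[OF W] le_trans by blast
    finally show "orbit_index V n \<le> C * scale G T \<phi> ^ n"
      by simp
  qed
qed

text \<open>The growth rate can only increase when the subgroup shrinks, so it suffices to bound that
  of the smaller group.\<close>

lemma growth_rate_eq_scale_if_orbit_convex_below:
  assumes U: "U \<in> compact_open_subgroups G T" and V: "V \<in> compact_open_subgroups G T"
    and "V \<subseteq> U" "orbit_convex V"
  shows "growth_rate U = scale G T \<phi>"
proof (rule antisym)
  obtain C where C: "\<And>n. orbit_index V n \<le> C * scale G T \<phi> ^ n"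
    using orbit_convex_orbit_index_le[OF V assms(4)] by blast
  have "growth_rate U ^ n \<le> (subgroup_index G U V * C) * scale G T \<phi> ^ n" for n
  proof -
    have "growth_rate U ^ n \<le> subgroup_index G U V * orbit_index V n"
      using growth_rate_power_le[OF U, of n] orbit_index_subset_le[OF U V assms(3), of n] by simp
    also have "\<dots> \<le> subgroup_index G U V * (C * scale G T \<phi> ^ n)"
      using C by simp
    finally show ?thesis
      by (simp add: mult.assoc)
  qed
  then show "growth_rate U \<le> scale G T \<phi>"
    using scale_pos by (rule le_if_power_le_const_mult_power)
qed (rule scale_le_growth_rate[OF U])

text \<open>By compactness, if all minimizing subgroups together meet in a subset of the open set \<open>U\<close>, then
  already finitely many of them do.\<close>

lemma orbit_convex_inside_if_nub_trivial:
  assumes nub: "nub G T \<phi> = {\<one>}" and U: "U \<in> compact_open_subgroups G T"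
  obtains V where "V \<in> compact_open_subgroups G T" "V \<subseteq> U" "orbit_convex V"
proof -
  obtain W where W: "minimizing G T \<phi> W"
    using minimizing_exists by blast
  have cos: "V \<in> compact_open_subgroups G T" if "minimizing G T \<phi> V" for V
    using that by (simp add: minimizing_def)
  \<comment> \<open>Together, \<open>U\<close> and the complements of the minimizing subgroups cover the compact group \<open>W\<close>.\<close>
  let ?\<U> = "insert U ((\<lambda>V. topspace T - V) ` {V. minimizing G T \<phi> V})"
  have "\<forall>A\<in>?\<U>. openin T A"
    using compact_open_subgroupsD(4)[OF cos] compact_open_subgroupsD(3)[OF U] by auto
  moreover have "W \<subseteq> \<Union>?\<U>"
  proof
    fix x assume x: "x \<in> W"
    then have "x \<in> topspace T"
      using compact_open_subgroupsD(5)[OF cos[OF W]] by (auto simp: topspace_eq)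
    moreover have "x \<in> U" if "x \<in> nub G T \<phi>"
      using that nub compact_open_subgroupsD(6)[OF U] by simp
    ultimately show "x \<in> \<Union>?\<U>"
      unfolding nub_def by blast
  qed
  ultimately obtain \<F> where \<F>: "finite \<F>" "\<F> \<subseteq> ?\<U>" "W \<subseteq> \<Union>\<F>"
    using compact_open_subgroupsD(2)[OF cos[OF W]] unfolding compactin_def by meson
  have "finite (\<F> - {U})" "\<F> - {U} \<subseteq> (\<lambda>V. topspace T - V) ` {V. minimizing G T \<phi> V}"
    using \<F> by auto
  then obtain \<M> where \<M>: "\<M> \<subseteq> {V. minimizing G T \<phi> V}" "finite \<M>"
    "\<F> - {U} = (\<lambda>V. topspace T - V) ` \<M>"
    by (meson finite_subset_image)
  let ?V = "\<Inter>(insert W \<M>)"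
  show ?thesis
  proof (rule that)
    have "\<Inter>(insert W \<N>) \<in> compact_open_subgroups G T"
      if "finite \<N>" "\<N> \<subseteq> {V. minimizing G T \<phi> V}" for \<N>
      using that
    proof (induction \<N>)
      case (insert V \<N>)
      then have "\<Inter>(insert W \<N>) \<inter> V \<in> compact_open_subgroups G T"
        using Int_compact_open_subgroups[OF _ cos[of V]] by simp
      moreover have "\<Inter>(insert W (insert V \<N>)) = \<Inter>(insert W \<N>) \<inter> V"
        by blast
      ultimately show ?case
        by simp
    qed (use cos[OF W] in simp)
    then show "?V \<in> compact_open_subgroups G T"
      using \<M> by blast
    show "?V \<subseteq> U"
    proof
      fix x assume x: "x \<in> ?V"
      then obtain A where "A \<in> \<F>" "x \<in> A"
        using \<F>(3) by blast
      moreover have "A \<notin> (\<lambda>V. topspace T - V) ` \<M>"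
        using x \<open>x \<in> A\<close> by blast
      ultimately show "x \<in> U"
        using \<M>(3) by blast
    qed
    show "orbit_convex ?V"
      using \<M>(1) W minimizing_imp_orbit_convex by (intro orbit_convex_Inter) auto
  qed
qed

lemma scale_eq_entropy_iff_nub_trivial:
  "ereal (ln (real (scale G T \<phi>))) = top_entropy G T \<phi> \<longleftrightarrow> nub G T \<phi> = {\<one>}"
proof
  let ?s = "scale G T \<phi>"
  have entropy: "top_entropy G T \<phi> = (SUP U\<in>compact_open_subgroups G T. ereal (ln (real (growth_rate U))))"
    unfolding top_entropy_def by (intro SUP_cong) (simp_all add: top_entropy_at_eq)
  {
    assume eq: "ereal (ln (real ?s)) = top_entropy G T \<phi>"
    have "nub G T \<phi> \<subseteq> U" if U: "U \<in> compact_open_subgroups G T" for U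
    proof -
      have "ereal (ln (real (growth_rate U))) \<le> ereal (ln (real ?s))"
        unfolding eq entropy by (rule SUP_upper[OF U])
      moreover have "0 < growth_rate U"
        using scale_pos scale_le_growth_rate[OF U] by linarith
      ultimately have "growth_rate U \<le> ?s"
        using scale_pos by simp
      then have "growth_rate U = ?s"
        using scale_le_growth_rate[OF U] by simp
      then obtain n where "minimizing G T \<phi> (stay U {0..int n})"
        using minimizing_stay_if_growth_rate[OF U] by blast
      then have "nub G T \<phi> \<subseteq> stay U {0..int n}"
        unfolding nub_def by blast
      also have "\<dots> \<subseteq> U"
        by (rule stay_subset) simp
      finally show ?thesis .
    qed
    then have "nub G T \<phi> \<subseteq> {\<one>}"
      unfolding Inter_compact_open_subgroups[symmetric] by blast
    moreover have "\<one> \<in> nub G T \<phi>"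
      unfolding nub_def minimizing_def using compact_open_subgroupsD(6) by blast
    ultimately show "nub G T \<phi> = {\<one>}"
      by blast
  next
    assume nub: "nub G T \<phi> = {\<one>}"
    have "growth_rate U = ?s" if U: "U \<in> compact_open_subgroups G T" for U
      using orbit_convex_inside_if_nub_trivial[OF nub U]
        growth_rate_eq_scale_if_orbit_convex_below[OF U] by metis
    then have "top_entropy G T \<phi> = (SUP U\<in>compact_open_subgroups G T. ereal (ln (real ?s)))"
      unfolding entropy by (intro SUP_cong) simp_all
    then show "ereal (ln (real ?s)) = top_entropy G T \<phi>"
      using compact_open_subgroup_exists by (metis SUP_const empty_iff)
  }
qed

end

theorem theorem1p3:
  fixes G :: "('a, 'b) monoid_scheme" and T :: "'a topology" and \<phi> :: "'a \<Rightarrow> 'a"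
  assumes "tdlc_group G T"
    and "topological_automorphism G T \<phi>"
  shows "ereal (ln (real (scale G T \<phi>))) = top_entropy G T \<phi> \<longleftrightarrow> nub G T \<phi> = {\<one>\<^bsub>G\<^esub>}"
proof -
  interpret tdlc_automorphism G T \<phi>
    using assms by (simp add: tdlc_automorphism_def tdlc_automorphism_axioms_def)
  show ?thesis
    by (rule scale_eq_entropy_iff_nub_trivial)
qed

end
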